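(* There is a tridiagonal model $A_t$ for $\beta$-Dyson Brownian motion such that its entries $(k,\ell)$ with $k+\ell\le n$ are finite variation processes.
   Context: $\beta$-Dyson Brownian motion with potential $V$ ($\beta\ge1$, almost surely simple starting configuration): $d\lambda_{i,t}=\sqrt{2/\beta}\,dZ_{i,t}-\bigl(\tfrac{V'(\lambda_{i,t})}{2}-\sum_{j\ne i}\tfrac1{\lambda_{i,t}-\lambda_{j,t}}\bigr)dt$, $1\le i\le n$, with $Z_1,\dots,Z_n$ independent standard Brownian motions. A tridiagonal model for it is a process $(A_t)_{t\ge0}$ of $n\times n$ real symmetric tridiagonal matrices for which there is an orthogonal matrix process $O$ with $A_t=O_t\Lambda_tO_t^t$, $\Lambda_t=\mathrm{diag}(\lambda_{1,t},\dots,\lambda_{n,t})$. *)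

theory Defs
  imports "HOL-Probability.Probability" "Jordan_Normal_Form.Matrix"
begin

section \<open>Filtrations and processes\<close>

text \<open>
  Time runs through \<open>[0,\<infinity>)\<close>, represented by the nonnegative reals; the values of a process at
  negative times are irrelevant. A filtration given on \<open>[0,\<infinity>)\<close> is extended to negative times,
  say by \<open>F t = F 0\<close>, only in order to be an instance of the library locale.
\<close>

definition usual_filtration :: "'a measure \<Rightarrow> (real \<Rightarrow> 'a measure) \<Rightarrow> bool" where
  "usual_filtration M F \<longleftrightarrow>
     filtration (space M) F \<and>
     (\<forall>t\<ge>0. subalgebra M (F t)) \<and>
     (\<forall>t\<ge>0. sets (F t) = (\<Inter>s\<in>{t<..}. sets (F s))) \<and>
     null_sets M \<subseteq> sets (F 0)"

definition continuous_adapted ::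
    "'a measure \<Rightarrow> (real \<Rightarrow> 'a measure) \<Rightarrow> (real \<Rightarrow> 'a \<Rightarrow> real) \<Rightarrow> bool" where
  "continuous_adapted M F X \<longleftrightarrow>
     (\<forall>t\<ge>0. X t \<in> borel_measurable (F t)) \<and>
     (AE \<omega> in M. continuous_on {0..} (\<lambda>t. X t \<omega>))"

definition bounded_variation_on :: "(real \<Rightarrow> real) \<Rightarrow> real set \<Rightarrow> bool" where
  "bounded_variation_on f S \<longleftrightarrow>
     (\<exists>B. \<forall>(N::nat) p. (\<forall>i\<le>N. p i \<in> S) \<and> (\<forall>i<N. p i \<le> p (Suc i)) \<longrightarrow>
        (\<Sum>i<N. \<bar>f (p (Suc i)) - f (p i)\<bar>) \<le> B)"

definition finite_variation_process ::
    "'a measure \<Rightarrow> (real \<Rightarrow> 'a measure) \<Rightarrow> (real \<Rightarrow> 'a \<Rightarrow> real) \<Rightarrow> bool" where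
  "finite_variation_process M F X \<longleftrightarrow>
     continuous_adapted M F X \<and>
     (AE \<omega> in M. \<forall>T\<ge>0. bounded_variation_on (\<lambda>t. X t \<omega>) {0..T})"

section \<open>Brownian motion\<close>

definition std_brownian_motion ::
    "'a measure \<Rightarrow> (real \<Rightarrow> 'a measure) \<Rightarrow> (real \<Rightarrow> 'a \<Rightarrow> real) \<Rightarrow> bool" where
  "std_brownian_motion M F W \<longleftrightarrow>
     continuous_adapted M F W \<and>
     (AE \<omega> in M. W 0 \<omega> = 0) \<and>
     (\<forall>s t. 0 \<le> s \<and> s < t \<longrightarrow>
        distributed M lborel (\<lambda>\<omega>. W t \<omega> - W s \<omega>) (normal_density 0 (sqrt (t - s))) \<and>
        prob_space.indep_set M (sets (F s))
          (sets (vimage_algebra (space M) (\<lambda>\<omega>. W t \<omega> - W s \<omega>) borel)))"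

text \<open>The processes are independent as random elements of the path space, i.e. jointly over all
  times.\<close>

definition independent_brownian_motions ::
    "'a measure \<Rightarrow> (real \<Rightarrow> 'a measure) \<Rightarrow> nat \<Rightarrow> (nat \<Rightarrow> real \<Rightarrow> 'a \<Rightarrow> real) \<Rightarrow> bool" where
  "independent_brownian_motions M F n Z \<longleftrightarrow>
     (\<forall>i<n. std_brownian_motion M F (Z i)) \<and>
     prob_space.indep_vars M (\<lambda>_. PiM {0..} (\<lambda>_. borel))
       (\<lambda>i \<omega>. \<lambda>t\<in>{0..}. Z i t \<omega>) {..<n}"

section \<open>Dyson Brownian motion with a potential\<close>

definition dyson_drift :: "(real \<Rightarrow> real) \<Rightarrow> nat \<Rightarrow> (nat \<Rightarrow> real) \<Rightarrow> nat \<Rightarrow> real" where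
  "dyson_drift V n x i = deriv V (x i) / 2 - (\<Sum>j\<in>{..<n} - {i}. 1 / (x i - x j))"

text \<open>
  Particles are numbered \<open>0, \<dots>, n - 1\<close>; \<open>lam i t \<omega>\<close> is the position of particle \<open>i\<close>
  at time \<open>t\<close>. Since the noise is additive, the equation in integral form involves only a pathwise
  Lebesgue integral. The drift is defined on simple configurations only (in HOL, \<open>1 / 0 = 0\<close>),
  so this set is the state space of the equation and a solution for all times stays in it.
\<close>

definition dyson_brownian_motion ::
    "'a measure \<Rightarrow> (real \<Rightarrow> 'a measure) \<Rightarrow> real \<Rightarrow> (real \<Rightarrow> real) \<Rightarrow> nat \<Rightarrow>
     (nat \<Rightarrow> real \<Rightarrow> 'a \<Rightarrow> real) \<Rightarrow> (nat \<Rightarrow> real \<Rightarrow> 'a \<Rightarrow> real) \<Rightarrow> bool" where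
  "dyson_brownian_motion M F \<beta> V n Z lam \<longleftrightarrow>
     independent_brownian_motions M F n Z \<and>
     (\<forall>i<n. continuous_adapted M F (lam i)) \<and>
     (AE \<omega> in M. inj_on (\<lambda>i. lam i 0 \<omega>) {..<n}) \<and>
     (AE \<omega> in M. \<forall>t>0. inj_on (\<lambda>i. lam i t \<omega>) {..<n}) \<and>
     (AE \<omega> in M. \<forall>t\<ge>0. \<forall>i<n.
        set_integrable lborel {0..t} (\<lambda>s. dyson_drift V n (\<lambda>j. lam j s \<omega>) i) \<and>
        lam i t \<omega> = lam i 0 \<omega> + sqrt (2 / \<beta>) * Z i t \<omega>
          - (LINT s:{0..t}|lborel. dyson_drift V n (\<lambda>j. lam j s \<omega>) i))"

section \<open>Tridiagonal models\<close>

definition symmetric_tridiagonal :: "nat \<Rightarrow> real mat \<Rightarrow> bool" where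
  "symmetric_tridiagonal n A \<longleftrightarrow>
     A \<in> carrier_mat n n \<and> transpose_mat A = A \<and>
     (\<forall>k<n. \<forall>l<n. k + 1 < l \<or> l + 1 < k \<longrightarrow> A $$ (k, l) = 0)"

text \<open>The library's \<open>orthogonal_mat\<close> does not ask for unit columns, hence the following.\<close>

definition real_orthogonal :: "nat \<Rightarrow> real mat \<Rightarrow> bool" where
  "real_orthogonal n Q \<longleftrightarrow>
     Q \<in> carrier_mat n n \<and> transpose_mat Q * Q = 1\<^sub>m n \<and> Q * transpose_mat Q = 1\<^sub>m n"

definition matrix_process ::
    "'a measure \<Rightarrow> (real \<Rightarrow> 'a measure) \<Rightarrow> nat \<Rightarrow> (real \<Rightarrow> 'a \<Rightarrow> real mat) \<Rightarrow> bool" where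
  "matrix_process M F n A \<longleftrightarrow>
     (\<forall>t\<ge>0. \<forall>\<omega>\<in>space M. A t \<omega> \<in> carrier_mat n n) \<and>
     (\<forall>k<n. \<forall>l<n. continuous_adapted M F (\<lambda>t \<omega>. A t \<omega> $$ (k, l)))"

definition tridiagonal_model ::
    "'a measure \<Rightarrow> (real \<Rightarrow> 'a measure) \<Rightarrow> nat \<Rightarrow> (nat \<Rightarrow> real \<Rightarrow> 'a \<Rightarrow> real) \<Rightarrow>
     (real \<Rightarrow> 'a \<Rightarrow> real mat) \<Rightarrow> bool" where
  "tridiagonal_model M F n lam A \<longleftrightarrow>
     matrix_process M F n A \<and>
     (\<forall>t\<ge>0. \<forall>\<omega>\<in>space M. symmetric_tridiagonal n (A t \<omega>)) \<and>
     (\<exists>Q. matrix_process M F n Q \<and>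
          (\<forall>t\<ge>0. \<forall>\<omega>\<in>space M. real_orthogonal n (Q t \<omega>)) \<and>
          (AE \<omega> in M. \<forall>t\<ge>0.
             A t \<omega> = Q t \<omega> * mat_diag n (\<lambda>i. lam i t \<omega>) * transpose_mat (Q t \<omega>)))"

end

(*
  The driving equation plays no role beyond the following: almost surely the particles move
  continuously and never collide. A tridiagonal matrix with eigenvalues x_i is determined by a
  positive spectral measure with masses w_i at x_i, and by the Chebyshev algorithm its entries (k,l)
  with k + l <= n are smooth functions of the moments of this measure of order less than n. Conversely n
  moments determine the n masses, so it suffices to find adapted moments of finite variation which
  stay in the cone of moments of positive measures on the moving nodes x(t). This cone is convex.
  For each rational time s, take the power sums of x(s) with a coefficient that grows linearly
  from zero at time s and is capped by the running infimum over r in [s,t] of a continuous function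
  that is positive iff these power sums are in the cone at time r. A superposition of these over s
  has finite variation and stays in the cone.
*)

theory Submission
  imports Defs "Jordan_Normal_Form.Determinant"
begin

section \<open>Continuous paths of locally bounded variation\<close>

text \<open>On each interval the increments are dominated by those of some \<open>g\<close>, which
  is then nondecreasing there. This is equivalent to bounded variation, but reduces closure
  properties to inequalities between increments, without partitions. Continuity is on the whole line
  because paths will be extended to negative times.\<close>

definition fv_path :: "(real \<Rightarrow> real) \<Rightarrow> bool" where
  "fv_path f \<longleftrightarrow> continuous_on UNIV f \<and>
     (\<forall>T. \<exists>g. \<forall>x y. 0 \<le> x \<and> x \<le> y \<and> y \<le> T \<longrightarrow> \<bar>f y - f x\<bar> \<le> g y - g x)"

lemma fv_path_continuous: "fv_path f \<Longrightarrow> continuous_on S f"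
  unfolding fv_path_def using continuous_on_subset by blast

lemma fv_pathE:
  assumes "fv_path f"
  obtains g where "\<And>x y. 0 \<le> x \<Longrightarrow> x \<le> y \<Longrightarrow> y \<le> T \<Longrightarrow> \<bar>f y - f x\<bar> \<le> g y - (g x::real)"
  using assms unfolding fv_path_def by meson

lemma fv_path_bounded_variation:
  assumes "fv_path f"
  shows "bounded_variation_on f {0..T}"
proof -
  obtain g where g: "\<And>x y. 0 \<le> x \<Longrightarrow> x \<le> y \<Longrightarrow> y \<le> T \<Longrightarrow> \<bar>f y - f x\<bar> \<le> g y - (g x::real)"
    using fv_pathE[OF assms, of T] by blast
  have "(\<Sum>i<N. \<bar>f (p (Suc i)) - f (p i)\<bar>) \<le> g T - g 0"
    if p: "\<forall>i\<le>N. p i \<in> {0..T}" "\<forall>i<N. p i \<le> p (Suc i)" for N :: nat and p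
  proof -
    have "(\<Sum>i<N. \<bar>f (p (Suc i)) - f (p i)\<bar>) \<le> (\<Sum>i<N. g (p (Suc i)) - g (p i))"
      using p by (intro sum_mono g) auto
    also have "\<dots> = g (p N) - g (p 0)"
      by (rule sum_lessThan_telescope)
    also have "\<dots> \<le> g T - g 0"
      using g[of "p N" T] g[of 0 "p 0"] p(1) by force
    finally show ?thesis .
  qed
  then show ?thesis
    unfolding bounded_variation_on_def by blast
qed

lemma fv_path_const: "fv_path (\<lambda>t. c)"
  unfolding fv_path_def by (auto intro!: exI[of _ "\<lambda>_. 0"])

section \<open>Closure of \<open>fv_path\<close> under algebraic operations, roots and
  series\<close>

lemma fv_path_add:
  assumes "fv_path f" "fv_path h"
  shows "fv_path (\<lambda>t. f t + h t)"
  unfolding fv_path_def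
proof (intro conjI allI)
  show "continuous_on UNIV (\<lambda>t. f t + h t)"
    using assms by (intro continuous_intros fv_path_continuous)
  fix T
  obtain g1 where g1: "\<And>x y. 0 \<le> x \<Longrightarrow> x \<le> y \<Longrightarrow> y \<le> T \<Longrightarrow> \<bar>f y - f x\<bar> \<le> g1 y - (g1 x::real)"
    using fv_pathE[OF assms(1), of T] by blast
  obtain g2 where g2: "\<And>x y. 0 \<le> x \<Longrightarrow> x \<le> y \<Longrightarrow> y \<le> T \<Longrightarrow> \<bar>h y - h x\<bar> \<le> g2 y - (g2 x::real)"
    using fv_pathE[OF assms(2), of T] by blast
  show "\<exists>g. \<forall>x y. 0 \<le> x \<and> x \<le> y \<and> y \<le> T \<longrightarrow> \<bar>f y + h y - (f x + h x)\<bar> \<le> g y - g x"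
    using g1 g2 by (intro exI[of _ "\<lambda>t. g1 t + g2 t"]) (smt (verit))
qed

text \<open>A Lipschitz constant \<open>C\<close> on the values taken in \<open>{0..T}\<close> makes
  \<open>C * g\<close> a dominating function. The constant may depend on the path and on
  \<open>T\<close>, so squares, inverses and roots are covered.\<close>

lemma fv_path_compose:
  assumes f: "fv_path f" and cont: "continuous_on UNIV (\<lambda>t. \<phi> (f t))"
    and lip: "\<And>T. \<exists>C\<ge>0. \<forall>x\<in>{0..T}. \<forall>y\<in>{0..T}. \<bar>\<phi> (f y) - \<phi> (f x)\<bar> \<le> C * \<bar>f y - f x\<bar>"
  shows "fv_path (\<lambda>t. \<phi> (f t))"
  unfolding fv_path_def
proof (intro conjI allI cont)
  fix T
  obtain g where g: "\<And>x y. 0 \<le> x \<Longrightarrow> x \<le> y \<Longrightarrow> y \<le> T \<Longrightarrow> \<bar>f y - f x\<bar> \<le> g y - (g x::real)"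
    using fv_pathE[OF f, of T] by blast
  obtain C where C: "C \<ge> 0" "\<And>x y. x \<in> {0..T} \<Longrightarrow> y \<in> {0..T} \<Longrightarrow> \<bar>\<phi> (f y) - \<phi> (f x)\<bar> \<le> C * \<bar>f y - f x\<bar>"
    using lip[of T] by blast
  have "\<bar>\<phi> (f y) - \<phi> (f x)\<bar> \<le> C * g y - C * g x" if "0 \<le> x" "x \<le> y" "y \<le> T" for x y
  proof -
    have "\<bar>\<phi> (f y) - \<phi> (f x)\<bar> \<le> C * \<bar>f y - f x\<bar>"
      using that by (intro C) auto
    also have "\<dots> \<le> C * (g y - g x)"
      using g that C(1) by (intro mult_left_mono) auto
    finally show ?thesis by (simp add: algebra_simps)
  qed
  then show "\<exists>g. \<forall>x y. 0 \<le> x \<and> x \<le> y \<and> y \<le> T \<longrightarrow> \<bar>\<phi> (f y) - \<phi> (f x)\<bar> \<le> g y - g x"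
    by (intro exI[of _ "\<lambda>t. C * g t"]) auto
qed

lemma fv_path_uminus:
  assumes "fv_path f"
  shows "fv_path (\<lambda>t. - f t)"
  using assms fv_path_continuous[OF assms]
  by (intro fv_path_compose[where \<phi> = uminus]) (auto intro!: continuous_intros exI[of _ 1])

lemma fv_path_diff: "fv_path f \<Longrightarrow> fv_path h \<Longrightarrow> fv_path (\<lambda>t. f t - h t)"
  using fv_path_add[OF _ fv_path_uminus, of f h] by simp

lemma fv_path_bound:
  assumes "fv_path f"
  obtains C where "C \<ge> 0" "\<And>x. x \<in> {0..T} \<Longrightarrow> \<bar>f x\<bar> \<le> C"
proof -
  have "bounded (f ` {0..T})"
    by (intro compact_imp_bounded compact_continuous_image fv_path_continuous assms) auto
  then obtain C where "\<forall>y\<in>f ` {0..T}. norm y \<le> C"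
    unfolding bounded_iff by blast
  then show ?thesis
    by (intro that[of "\<bar>C\<bar>"]) force+
qed

lemma fv_path_square:
  assumes "fv_path f"
  shows "fv_path (\<lambda>t. (f t)\<^sup>2)"
proof (rule fv_path_compose[OF assms])
  show "continuous_on UNIV (\<lambda>t. (f t)\<^sup>2)"
    by (intro continuous_intros fv_path_continuous assms)
  fix T
  obtain C where C: "C \<ge> 0" "\<And>x. x \<in> {0..T} \<Longrightarrow> \<bar>f x\<bar> \<le> C"
    using fv_path_bound[OF assms] by metis
  have "\<bar>(f y)\<^sup>2 - (f x)\<^sup>2\<bar> \<le> 2 * C * \<bar>f y - f x\<bar>" if "x \<in> {0..T}" "y \<in> {0..T}" for x y
  proof -
    have "\<bar>(f y)\<^sup>2 - (f x)\<^sup>2\<bar> = \<bar>f y + f x\<bar> * \<bar>f y - f x\<bar>"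
      by (simp add: power2_eq_square algebra_simps flip: abs_mult)
    then show ?thesis
      using C(2)[OF that(1)] C(2)[OF that(2)] by (auto intro!: mult_right_mono)
  qed
  then show "\<exists>C\<ge>0. \<forall>x\<in>{0..T}. \<forall>y\<in>{0..T}. \<bar>(f y)\<^sup>2 - (f x)\<^sup>2\<bar> \<le> C * \<bar>f y - f x\<bar>"
    using C(1) by (intro exI[of _ "2 * C"]) auto
qed

lemma fv_path_cmult:
  assumes "fv_path f"
  shows "fv_path (\<lambda>t. c * f t)"
  using assms fv_path_continuous[OF assms]
  by (intro fv_path_compose[where \<phi> = "(*) c"])
     (auto intro!: continuous_intros exI[of _ "\<bar>c\<bar>"] simp flip: abs_mult simp: algebra_simps)

text \<open>Polarisation reduces products to squares, hence to composition with a function of one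
  variable.\<close>

lemma fv_path_mult:
  assumes "fv_path f" "fv_path h"
  shows "fv_path (\<lambda>t. f t * h t)"
proof -
  have "fv_path (\<lambda>t. (1/4) * ((f t + h t)\<^sup>2 - (f t - h t)\<^sup>2))"
    by (intro fv_path_cmult fv_path_diff fv_path_square fv_path_add assms)
  then show ?thesis
    by (simp add: power2_eq_square algebra_simps)
qed

lemma fv_path_bounded_below:
  assumes "fv_path f" "\<And>t. f t > 0"
  obtains d where "d > 0" "\<And>x. x \<in> {0..T} \<Longrightarrow> d \<le> f x"
proof (cases "T \<ge> 0")
  case True
  then have "\<exists>x\<in>{0..T}. \<forall>y\<in>{0..T}. f x \<le> f y"
    by (intro continuous_attains_inf fv_path_continuous assms) auto
  then show ?thesis
    using assms(2) that by blast
next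
  case False
  then show ?thesis by (intro that[of 1]) auto
qed

text \<open>A positive continuous path has a positive lower bound \<open>d\<close> on
  \<open>{0..T}\<close>, and above \<open>d\<close> inversion has Lipschitz constant 1 /
  d^2.\<close>

lemma fv_path_inverse:
  assumes f: "fv_path f" and pos: "\<And>t. f t > 0"
  shows "fv_path (\<lambda>t. inverse (f t))"
proof (rule fv_path_compose[OF f])
  show "continuous_on UNIV (\<lambda>t. inverse (f t))"
    using pos by (intro continuous_intros fv_path_continuous f) (auto simp: less_imp_neq[symmetric])
  fix T
  obtain d where d: "d > 0" "\<And>x. x \<in> {0..T} \<Longrightarrow> d \<le> f x"
    using fv_path_bounded_below[OF f pos, where T = T] by metis
  have "\<bar>inverse (f y) - inverse (f x)\<bar> \<le> inverse (d * d) * \<bar>f y - f x\<bar>"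
    if "x \<in> {0..T}" "y \<in> {0..T}" for x y
  proof -
    have "\<bar>inverse (f y) - inverse (f x)\<bar> = inverse (f x * f y) * \<bar>f y - f x\<bar>"
      using pos[of x] pos[of y] by (simp add: field_simps abs_if)
    also have "\<dots> \<le> inverse (d * d) * \<bar>f y - f x\<bar>"
      using d(1) d(2)[OF that(1)] d(2)[OF that(2)]
      by (intro mult_right_mono le_imp_inverse_le mult_mono) auto
    finally show ?thesis .
  qed
  then show "\<exists>C\<ge>0. \<forall>x\<in>{0..T}. \<forall>y\<in>{0..T}. \<bar>inverse (f y) - inverse (f x)\<bar> \<le> C * \<bar>f y - f x\<bar>"
    using d(1) by (intro exI[of _ "inverse (d * d)"]) auto
qed

lemma fv_path_divide: "fv_path f \<Longrightarrow> fv_path h \<Longrightarrow> (\<And>t. h t > 0) \<Longrightarrow> fv_path (\<lambda>t. f t / h t)"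
  using fv_path_mult[OF _ fv_path_inverse, of f h] by (simp add: field_simps)

lemma fv_path_sqrt:
  assumes f: "fv_path f" and pos: "\<And>t. f t > 0"
  shows "fv_path (\<lambda>t. sqrt (f t))"
proof (rule fv_path_compose[OF f])
  show "continuous_on UNIV (\<lambda>t. sqrt (f t))"
    by (intro continuous_intros fv_path_continuous f)
  fix T
  obtain d where d: "d > 0" "\<And>x. x \<in> {0..T} \<Longrightarrow> d \<le> f x"
    using fv_path_bounded_below[OF f pos, where T = T] by metis
  have "\<bar>sqrt (f y) - sqrt (f x)\<bar> \<le> inverse (sqrt d) * \<bar>f y - f x\<bar>"
    if "x \<in> {0..T}" "y \<in> {0..T}" for x y
  proof -
    \<comment> \<open>One of the two roots already bounds their sum from below by
      \<open>sqrt d\<close>; the other is dropped.\<close>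
    have "\<bar>sqrt (f y) - sqrt (f x)\<bar> * sqrt d \<le> \<bar>sqrt (f y) - sqrt (f x)\<bar> * (sqrt (f y) + sqrt (f x))"
      using d(1) d(2)[OF that(1)] d(2)[OF that(2)] pos[of x]
      by (intro mult_left_mono add_increasing2) auto
    also have "\<dots> = \<bar>(sqrt (f y) - sqrt (f x)) * (sqrt (f y) + sqrt (f x))\<bar>"
      using pos[of x] pos[of y] by (simp add: abs_mult)
    also have "\<dots> = \<bar>f y - f x\<bar>"
      using pos[of x] pos[of y] by (simp add: algebra_simps)
    finally show ?thesis using d(1) by (simp add: field_simps)
  qed
  then show "\<exists>C\<ge>0. \<forall>x\<in>{0..T}. \<forall>y\<in>{0..T}. \<bar>sqrt (f y) - sqrt (f x)\<bar> \<le> C * \<bar>f y - f x\<bar>"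
    using d(1) by (intro exI[of _ "inverse (sqrt d)"]) auto
qed

text \<open>The M-test gives continuity. The series of \<open>\<bar>c j\<bar> * g j t\<close>
  converges because of the common bound \<open>B\<close>, and it dominates the increments.\<close>

lemma fv_path_suminf:
  fixes \<kappa> g :: "nat \<Rightarrow> real \<Rightarrow> real"
  assumes c: "summable (\<lambda>j. \<bar>c j\<bar>)"
    and \<kappa>: "\<And>j. continuous_on UNIV (\<kappa> j)" "\<And>j t. \<bar>\<kappa> j t\<bar> \<le> 1"
    and g: "\<And>j t. \<bar>g j t\<bar> \<le> B" "\<And>j x y. x \<le> y \<Longrightarrow> \<bar>\<kappa> j y - \<kappa> j x\<bar> \<le> g j y - g j x"
  shows "fv_path (\<lambda>t. \<Sum>j. c j * \<kappa> j t)"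
  unfolding fv_path_def
proof (intro conjI allI)
  have le: "\<bar>c j * \<kappa> j t\<bar> \<le> \<bar>c j\<bar>" for j t
    using \<kappa>(2)[of j t] by (simp add: abs_mult mult_left_le)
  have "uniform_limit UNIV (\<lambda>n t. \<Sum>j<n. c j * \<kappa> j t) (\<lambda>t. \<Sum>j. c j * \<kappa> j t) sequentially"
    using le by (intro Weierstrass_m_test[OF _ c]) auto
  then show "continuous_on UNIV (\<lambda>t. \<Sum>j. c j * \<kappa> j t)"
    by (rule uniform_limit_theorem[rotated])
       (auto intro!: always_eventually continuous_intros \<kappa>)
  have sum1: "summable (\<lambda>j. c j * \<kappa> j t)" for t
    using le by (intro summable_comparison_test[OF _ c]) auto
  have "\<bar>\<bar>c j\<bar> * g j t\<bar> \<le> \<bar>c j\<bar> * B" for j t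
    using g(1)[of j t] by (simp add: abs_mult mult_left_mono)
  then have sum2: "summable (\<lambda>j. \<bar>c j\<bar> * g j t)" for t
    by (intro summable_comparison_test[OF _ summable_mult2[OF c, of B]]) auto
  fix T
  have "\<bar>(\<Sum>j. c j * \<kappa> j y) - (\<Sum>j. c j * \<kappa> j x)\<bar> \<le> (\<Sum>j. \<bar>c j\<bar> * g j y) - (\<Sum>j. \<bar>c j\<bar> * g j x)"
    if "x \<le> y" for x y
  proof -
    have *: "\<bar>c j * \<kappa> j y - c j * \<kappa> j x\<bar> \<le> \<bar>c j\<bar> * g j y - \<bar>c j\<bar> * g j x" for j
      using mult_left_mono[OF g(2)[OF that, of j], of "\<bar>c j\<bar>"]
      by (simp add: algebra_simps flip: abs_mult)
    have s: "summable (\<lambda>j. \<bar>c j\<bar> * g j y - \<bar>c j\<bar> * g j x)"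
      by (intro summable_diff sum2)
    have "\<bar>(\<Sum>j. c j * \<kappa> j y) - (\<Sum>j. c j * \<kappa> j x)\<bar> = \<bar>\<Sum>j. c j * \<kappa> j y - c j * \<kappa> j x\<bar>"
      by (simp add: suminf_diff sum1)
    also have "\<dots> \<le> (\<Sum>j. \<bar>c j\<bar> * g j y - \<bar>c j\<bar> * g j x)"
      using norm_suminf_le[where f = "\<lambda>j. c j * \<kappa> j y - c j * \<kappa> j x", OF _ s] * by simp
    also have "\<dots> = (\<Sum>j. \<bar>c j\<bar> * g j y) - (\<Sum>j. \<bar>c j\<bar> * g j x)"
      by (simp add: suminf_diff sum2)
    finally show ?thesis .
  qed
  then show "\<exists>G. \<forall>x y. 0 \<le> x \<and> x \<le> y \<and> y \<le> T \<longrightarrow>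
      \<bar>(\<Sum>j. c j * \<kappa> j y) - (\<Sum>j. c j * \<kappa> j x)\<bar> \<le> G y - G x"
    by (intro exI[of _ "\<lambda>t. \<Sum>j. \<bar>c j\<bar> * g j t"]) auto
qed

section \<open>Running infimum\<close>

text \<open>Only rational times enter, so that the running infimum of a process is measurable
  without any regularity of its paths; for continuous paths they suffice.\<close>

definition running_inf :: "(real \<Rightarrow> real) \<Rightarrow> real \<Rightarrow> real \<Rightarrow> real" where
  "running_inf f s t = (INF r\<in>insert s ({s<..<t} \<inter> \<rat>). f r)"

text \<open>The times at which \<open>f\<close> is at least the infimum form a closed set containing
  the rationals of the open interval, hence all of \<open>{s..t}\<close>. For t <= s the infimum is
  \<open>f s\<close> and r = s is the only time allowed, whence \<open>max s t\<close>.\<close>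

lemma running_inf_le:
  assumes cont: "continuous_on UNIV f" and nn: "\<And>r. f r \<ge> 0" and r: "s \<le> r" "r \<le> max s t"
  shows "running_inf f s t \<le> f r"
proof -
  let ?I = "running_inf f s t"
  have bdd: "bdd_below (f ` A)" for A
    using nn by (intro bdd_belowI2[of _ 0]) auto
  have I: "?I \<le> f q" if "q \<in> insert s ({s<..<t} \<inter> \<rat>)" for q
    unfolding running_inf_def using that by (intro cINF_lower bdd)
  show ?thesis
  proof (cases "s < t")
    case True
    have "closed {q. ?I \<le> f q}"
      using cont by (intro closed_Collect_le continuous_intros) auto
    then have "closure ({s<..<t} \<inter> \<rat>) \<subseteq> {q. ?I \<le> f q}"
      using I by (intro closure_minimal) auto
    moreover have "closure ({s<..<t} \<inter> \<rat>) = {s..t}"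
      using closure_open_Int_superset[of "{s<..<t}" \<rat>] True Rats_closure_real by simp
    ultimately show ?thesis using r True by auto
  next
    case False
    then show ?thesis using r I[of s] by auto
  qed
qed

lemma running_inf_ge:
  assumes "\<And>r. s \<le> r \<Longrightarrow> r \<le> max s t \<Longrightarrow> c \<le> f r"
  shows "c \<le> running_inf f s t"
  unfolding running_inf_def using assms by (intro cINF_greatest) auto

lemma running_inf_antimono:
  assumes "\<And>r. f r \<ge> 0" "t \<le> t'"
  shows "running_inf f s t' \<le> running_inf f s t"
proof -
  have "bdd_below (f ` A)" for A
    using assms(1) by (intro bdd_belowI2[of _ 0]) auto
  then show ?thesis
    unfolding running_inf_def using assms(2) by (intro cINF_superset_mono) auto
qed

text \<open>Passing from \<open>t\<close> to a slightly later time only adds values of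
  \<open>f\<close> close to one that the infimum at \<open>t\<close> already takes into account, so
  this nonincreasing function drops only a little.\<close>

lemma continuous_on_running_inf:
  assumes cont: "continuous_on UNIV f" and nn: "\<And>r. f r \<ge> 0"
  shows "continuous_on UNIV (running_inf f s)"
  unfolding continuous_on_iff
proof (intro ballI allI impI)
  fix t0 e :: real assume e: "0 < e"
  then obtain d where d: "d > 0" "\<And>r. dist r t0 < d \<Longrightarrow> dist (f r) (f t0) < e / 4"
    using cont[unfolded continuous_on_iff, rule_format, of t0 "e / 4"] by auto
  have near: "running_inf f s t - e / 2 \<le> running_inf f s t'"
    if t: "t \<le> t'" "dist t t0 < d" "dist t' t0 < d" for t t'
  proof (rule running_inf_ge)
    fix r assume r: "s \<le> r" "r \<le> max s t'"
    show "running_inf f s t - e / 2 \<le> f r"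
    proof (cases "r \<le> max s t")
      case True
      then show ?thesis using running_inf_le[OF cont nn r(1) True] e by simp
    next
      case False
      \<comment> \<open>\<open>max s t\<close> lies between \<open>t\<close> and \<open>r\<close>,
        hence in the same neighbourhood of \<open>t0\<close>, and it is a time covered by the
        infimum up to \<open>t\<close>. Two errors e / 4 make e / 2.\<close>
      then have "dist r t0 < d" "dist (max s t) t0 < d"
        using t r by (auto simp: dist_real_def)
      from this[THEN d(2)] have "f (max s t) \<le> f r + e / 2"
        unfolding dist_real_def by linarith
      then show ?thesis
        using running_inf_le[OF cont nn, of s "max s t" t] by simp
    qed
  qed
  have "dist (running_inf f s t) (running_inf f s t0) < e" if "dist t t0 < d" for t
    using near[of t t0] near[of t0 t] that e d(1)
      running_inf_antimono[where f = f and s = s, OF nn, of t t0]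
      running_inf_antimono[where f = f and s = s, OF nn, of t0 t]
    by (cases "t \<le> t0") (auto simp: dist_real_def)
  then show "\<exists>d>0. \<forall>t\<in>UNIV. dist t t0 < d \<longrightarrow> dist (running_inf f s t) (running_inf f s t0) < e"
    using d(1) by blast
qed

section \<open>Orthogonal polynomials of a discrete measure\<close>

definition ip :: "nat \<Rightarrow> (nat \<Rightarrow> real) \<Rightarrow> (nat \<Rightarrow> real) \<Rightarrow> (nat \<Rightarrow> real) \<Rightarrow> real" where
  "ip n w u v = (\<Sum>i<n. w i * u i * v i)"

lemma ip_commute: "ip n w u v = ip n w v u"
  by (simp add: ip_def mult.commute mult.left_commute)

lemma ip_lincomb_left:
  "ip n w (\<lambda>i. a i + b * c i + d * e i) v = ip n w a v + b * ip n w c v + d * ip n w e v"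
  by (simp add: ip_def algebra_simps sum.distrib sum_distrib_left)

lemma ip_shift: "ip n w (\<lambda>i. x i * u i) v = ip n w u (\<lambda>i. x i * v i)"
  by (simp add: ip_def mult.commute mult.left_commute)

text \<open>\<open>opoly n x w j i\<close> is the value at the node \<open>x i\<close> of the monic orthogonal polynomial of degree
  \<open>j\<close> for the measure with mass \<open>w i\<close> at \<open>x i\<close>, computed by Stieltjes' three-term recurrence.\<close>

fun opoly :: "nat \<Rightarrow> (nat \<Rightarrow> real) \<Rightarrow> (nat \<Rightarrow> real) \<Rightarrow> nat \<Rightarrow> nat \<Rightarrow> real" where
  "opoly n x w 0 = (\<lambda>i. 1)"
| "opoly n x w (Suc 0) = (\<lambda>i. x i - ip n w x (\<lambda>_. 1) / ip n w (\<lambda>_. 1) (\<lambda>_. 1))"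
| "opoly n x w (Suc (Suc j)) = (let p = opoly n x w (Suc j); q = opoly n x w j in
     (\<lambda>i. (x i - ip n w (\<lambda>i. x i * p i) p / ip n w p p) * p i - ip n w p p / ip n w q q * q i))"

definition sqnorm :: "nat \<Rightarrow> (nat \<Rightarrow> real) \<Rightarrow> (nat \<Rightarrow> real) \<Rightarrow> nat \<Rightarrow> real" where
  "sqnorm n x w j = ip n w (opoly n x w j) (opoly n x w j)"

definition rec_alpha :: "nat \<Rightarrow> (nat \<Rightarrow> real) \<Rightarrow> (nat \<Rightarrow> real) \<Rightarrow> nat \<Rightarrow> real" where
  "rec_alpha n x w j = ip n w (\<lambda>i. x i * opoly n x w j i) (opoly n x w j) / sqnorm n x w j"

text \<open>The value 0 at \<open>j = 0\<close> removes the term with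
  \<open>opoly n x w (0 - 1)\<close>, which is \<open>opoly n x w 0\<close> by truncated
  subtraction; one recurrence then covers all degrees.\<close>

definition rec_beta :: "nat \<Rightarrow> (nat \<Rightarrow> real) \<Rightarrow> (nat \<Rightarrow> real) \<Rightarrow> nat \<Rightarrow> real" where
  "rec_beta n x w j = (if j = 0 then 0 else sqnorm n x w j / sqnorm n x w (j - 1))"

text \<open>The table of the Chebyshev algorithm: row \<open>j = 0\<close> holds the moments, and
  every further row is computed from at most two rows before it.\<close>

definition mixed_moment :: "nat \<Rightarrow> (nat \<Rightarrow> real) \<Rightarrow> (nat \<Rightarrow> real) \<Rightarrow> nat \<Rightarrow> nat \<Rightarrow> real" where
  "mixed_moment n x w j l = ip n w (opoly n x w j) (\<lambda>i. x i ^ l)"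

lemma opoly_recurrence:
  "x i * opoly n x w j i =
     opoly n x w (Suc j) i + rec_alpha n x w j * opoly n x w j i
       + rec_beta n x w j * opoly n x w (j - 1) i"
  by (cases j) (auto simp: rec_alpha_def rec_beta_def sqnorm_def Let_def algebra_simps)

lemma ip_shift_opoly:
  "ip n w (\<lambda>i. x i * opoly n x w j i) v =
     ip n w (opoly n x w (Suc j)) v + rec_alpha n x w j * ip n w (opoly n x w j) v
       + rec_beta n x w j * ip n w (opoly n x w (j - 1)) v"
  unfolding opoly_recurrence by (rule ip_lincomb_left)

text \<open>Multiplication by the nodes is self-adjoint, so one factor moves from the power to the
  polynomial, where the three-term recurrence applies.\<close>

lemma mixed_moment_Suc:
  "mixed_moment n x w j (Suc l) =
     mixed_moment n x w (Suc j) l + rec_alpha n x w j * mixed_moment n x w j l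
       + rec_beta n x w j * mixed_moment n x w (j - 1) l"
  unfolding mixed_moment_def power_Suc ip_shift[symmetric] by (rule ip_shift_opoly)

text \<open>Prepares the root count in \<open>sqnorm_pos\<close>: a single polynomial of exact
  degree \<open>j\<close> represents the values at all nodes.\<close>

lemma opoly_monic:
  "\<exists>p. Polynomial.degree p = j \<and> Polynomial.coeff p j = 1 \<and> (\<forall>i. opoly n x w j i = poly p (x i))"
proof (induction j rule: less_induct)
  case (less j)
  show ?case
  proof (cases j)
    case 0
    then show ?thesis by (intro exI[of _ 1]) auto
  next
    case (Suc k)
    obtain p where p: "Polynomial.degree p = k" "Polynomial.coeff p k = 1"
        "\<And>i. opoly n x w k i = poly p (x i)"
      using less[of k] Suc by auto
    obtain q where q: "Polynomial.degree q = k - 1" "\<And>i. opoly n x w (k - 1) i = poly q (x i)"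
      using less[of "k - 1"] Suc less_Suc_eq_le[of "k - 1" k] by auto
    define r where "r = pCons 0 p - Polynomial.smult (rec_alpha n x w k) p
                          - Polynomial.smult (rec_beta n x w k) q"
    have "opoly n x w j i = poly r (x i)" for i
      using opoly_recurrence[of x i n w k] unfolding Suc r_def
      by (simp add: p q[unfolded One_nat_def] algebra_simps)
    moreover have "Polynomial.coeff r j = 1"
      using p q by (simp add: r_def Suc coeff_eq_0)
    moreover have "Polynomial.degree r \<le> j"
      unfolding r_def Suc using p(1) q(1)
      by (intro degree_diff_le) (auto intro: order.trans[OF degree_smult_le] degree_pCons_le)
    ultimately show ?thesis
      by (metis le_antisym le_degree zero_neq_one)
  qed
qed

section \<open>Orthogonality, and the recurrence coefficients in terms of moments\<close>

locale simple_measure =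
  fixes n :: nat and x w :: "nat \<Rightarrow> real"
  assumes inj: "inj_on x {..<n}" and pos: "\<And>i. i < n \<Longrightarrow> w i > 0"
begin

text \<open>A monic polynomial of degree \<open>j < n\<close> cannot vanish at all \<open>n\<close>
  distinct nodes, and the masses are positive.\<close>

lemma sqnorm_pos:
  assumes "j < n"
  shows "sqnorm n x w j > 0"
proof -
  obtain p where p: "Polynomial.degree p = j" "Polynomial.coeff p j = 1"
      "\<And>i. opoly n x w j i = poly p (x i)"
    using opoly_monic[of j n x w] by auto
  then have "p \<noteq> 0" by auto
  have "\<exists>i<n. opoly n x w j i \<noteq> 0"
  proof (rule ccontr)
    assume "\<not> (\<exists>i<n. opoly n x w j i \<noteq> 0)"
    then have "x ` {..<n} \<subseteq> {z. poly p z = 0}"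
      using p(3) by auto
    then have "card (x ` {..<n}) \<le> card {z. poly p z = 0}"
      by (intro card_mono poly_roots_finite \<open>p \<noteq> 0\<close>)
    then show False
      using card_poly_roots_bound[OF \<open>p \<noteq> 0\<close>] p(1) assms by (simp add: card_image inj)
  qed
  then obtain i where i: "i < n" "opoly n x w j i \<noteq> 0" by blast
  have "w k * opoly n x w j k * opoly n x w j k \<ge> 0" if "k < n" for k
    using pos[OF that] by (simp add: mult.assoc)
  moreover have "w i * opoly n x w j i * opoly n x w j i > 0"
    using pos[OF i(1)] i(2) by (simp add: mult.assoc zero_less_mult_iff)
      (use linorder_neqE_linordered_idom in blast)
  ultimately show ?thesis
    unfolding sqnorm_def ip_def using i(1) by (intro sum_pos2[of _ i]) auto
qed

text \<open>Induction with the recurrence for degree m + 1: the product with degree m vanishes by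
  the choice of \<open>rec_alpha\<close>, that with degree m - 1 by the choice of
  \<open>rec_beta\<close>. For smaller k, multiplication by the nodes moves to the second factor and
  raises its degree at most to k + 1 < m.\<close>

lemma opoly_orthogonal_less: "k < j \<Longrightarrow> j < n \<Longrightarrow> ip n w (opoly n x w j) (opoly n x w k) = 0"
proof (induction j arbitrary: k rule: less_induct)
  case (less j)
  then obtain m where j: "j = Suc m" by (cases j) auto
  have IH: "ip n w (opoly n x w m) (opoly n x w l) = 0" if "l < m" for l
    using less.IH[of m l] that less.prems by (auto simp: j)
  have IH': "ip n w (opoly n x w (m - 1)) (opoly n x w l) = 0" if "l < m - 1" for l
    using less.IH[of "m - 1" l] that less.prems by (auto simp: j)
  have h: "sqnorm n x w m > 0" "m > 0 \<Longrightarrow> sqnorm n x w (m - 1) > 0"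
    using less.prems by (auto intro!: sqnorm_pos simp: j)
  have rec: "ip n w (opoly n x w (Suc m)) (opoly n x w k) =
      ip n w (\<lambda>i. x i * opoly n x w m i) (opoly n x w k)
      - rec_alpha n x w m * ip n w (opoly n x w m) (opoly n x w k)
      - rec_beta n x w m * ip n w (opoly n x w (m - 1)) (opoly n x w k)"
    using ip_shift_opoly[of n w x m "opoly n x w k"] by simp
  consider "k = m" | "k < m" "k = m - 1" | "k < m - 1"
    using less.prems j by linarith
  then show ?case
  proof cases
    case 1
    have "rec_beta n x w m * ip n w (opoly n x w (m - 1)) (opoly n x w m) = 0"
      using IH[of "m - 1"] by (cases "m = 0") (auto simp: rec_beta_def ip_commute)
    then show ?thesis
      using rec h 1 by (simp add: j rec_alpha_def sqnorm_def)
  next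
    case 2
    have "ip n w (\<lambda>i. x i * opoly n x w m i) (opoly n x w k)
        = ip n w (\<lambda>i. x i * opoly n x w k i) (opoly n x w m)"
      by (subst ip_shift) (rule ip_commute)
    also have "\<dots> = sqnorm n x w m + rec_alpha n x w k * 0
        + rec_beta n x w k * ip n w (opoly n x w (k - 1)) (opoly n x w m)"
      using IH[OF 2(1)] 2(1) unfolding ip_shift_opoly
      by (simp add: 2(2) sqnorm_def ip_commute[of n w "opoly n x w (m - Suc 0)"])
    also have "rec_beta n x w k * ip n w (opoly n x w (k - 1)) (opoly n x w m) = 0"
      using IH[of "k - 1"] 2 by (simp add: rec_beta_def ip_commute)
    finally show ?thesis
      using rec h IH[of k] 2 by (simp add: j rec_beta_def sqnorm_def)
  next
    case 3
    have "ip n w (\<lambda>i. x i * opoly n x w m i) (opoly n x w k)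
        = ip n w (\<lambda>i. x i * opoly n x w k i) (opoly n x w m)"
      by (subst ip_shift) (rule ip_commute)
    also have "\<dots> = 0"
      using IH[of "Suc k"] IH[of k] IH[of "k - 1"] 3
      by (simp add: ip_shift_opoly ip_commute[of n w _ "opoly n x w m"])
    finally show ?thesis
      using rec IH[of k] IH'[of k] 3 by (simp add: j)
  qed
qed

lemma opoly_orthogonal:
  "j < n \<Longrightarrow> k < n \<Longrightarrow> ip n w (opoly n x w j) (opoly n x w k) = (if j = k then sqnorm n x w j else 0)"
  using opoly_orthogonal_less[of k j] opoly_orthogonal_less[of j k]
  by (cases j k rule: linorder_cases) (auto simp: sqnorm_def ip_commute)

text \<open>The recurrence lowers the power by one and changes the degree by at most one, so both
  bounds persist down to power 0, where orthogonality to the constant applies.\<close>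

lemma mixed_moment_eq_0: "l < j \<Longrightarrow> j + l < n \<Longrightarrow> mixed_moment n x w j l = 0"
proof (induction l arbitrary: j)
  case 0
  then show ?case
    using opoly_orthogonal_less[of 0 j] by (simp add: mixed_moment_def)
next
  case (Suc l)
  then show ?case by (simp add: mixed_moment_Suc)
qed

text \<open>In the recurrence only the term with \<open>rec_beta\<close> survives; this coefficient
  is a quotient of consecutive squared norms, so the diagonal telescopes.\<close>

lemma mixed_moment_diag: "j + j < n \<Longrightarrow> mixed_moment n x w j j = sqnorm n x w j"
proof (induction j)
  case 0
  then show ?case by (simp add: mixed_moment_def sqnorm_def)
next
  case (Suc j)
  then have "mixed_moment n x w (Suc j) (Suc j) = rec_beta n x w (Suc j) * sqnorm n x w j"
    by (simp add: mixed_moment_Suc mixed_moment_eq_0)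
  then show ?case
    using sqnorm_pos[of j] Suc.prems by (simp add: rec_beta_def)
qed

text \<open>The recurrence at l = j, where the entry in row j + 1 vanishes and the diagonal entry is
  the squared norm. Only table entries with index sum at most 2 j + 1 occur.\<close>

lemma rec_alpha_eq:
  assumes "Suc (j + j) < n"
  shows "rec_alpha n x w j =
    (mixed_moment n x w j (Suc j) - rec_beta n x w j * mixed_moment n x w (j - 1) j) / sqnorm n x w j"
  using mixed_moment_Suc[of n x w j j] mixed_moment_eq_0[of j "Suc j"] mixed_moment_diag[of j]
    sqnorm_pos[of j] assms by (simp add: field_simps)

lemma jacobi_tridiagonal:
  assumes "j < n" "k < n" "Suc j < k"
  shows "ip n w (\<lambda>i. x i * opoly n x w j i) (opoly n x w k) = 0"
  using assms by (simp add: ip_shift_opoly opoly_orthogonal)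

lemma jacobi_subdiagonal:
  assumes "Suc j < n"
  shows "ip n w (\<lambda>i. x i * opoly n x w j i) (opoly n x w (Suc j)) = sqnorm n x w (Suc j)"
  using assms by (simp add: ip_shift_opoly opoly_orthogonal)

end

text \<open>The eigenvectors of the Jacobi matrix: the rows are the orthonormal polynomials,
  the column \<open>i\<close> is weighted by \<open>sqrt (w i)\<close>.\<close>

definition jacobi_vec :: "nat \<Rightarrow> (nat \<Rightarrow> real) \<Rightarrow> (nat \<Rightarrow> real) \<Rightarrow> nat \<Rightarrow> nat \<Rightarrow> real" where
  "jacobi_vec n x w j i = opoly n x w j i * sqrt (w i) / sqrt (sqnorm n x w j)"

definition jacobi_vec_mat :: "nat \<Rightarrow> (nat \<Rightarrow> real) \<Rightarrow> (nat \<Rightarrow> real) \<Rightarrow> real mat" where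
  "jacobi_vec_mat n x w = Matrix.mat n n (\<lambda>(j, i). jacobi_vec n x w j i)"

text \<open>Taken from the spectral decomposition, so that \<open>jacobi_mat_eq\<close> is
  immediate; the link with the recurrence coefficients is established afterwards.\<close>

definition jacobi_entry :: "nat \<Rightarrow> (nat \<Rightarrow> real) \<Rightarrow> (nat \<Rightarrow> real) \<Rightarrow> nat \<Rightarrow> nat \<Rightarrow> real" where
  "jacobi_entry n x w j k = (\<Sum>i<n. jacobi_vec n x w j i * x i * jacobi_vec n x w k i)"

definition jacobi_mat :: "nat \<Rightarrow> (nat \<Rightarrow> real) \<Rightarrow> (nat \<Rightarrow> real) \<Rightarrow> real mat" where
  "jacobi_mat n x w = Matrix.mat n n (\<lambda>(j, k). jacobi_entry n x w j k)"

lemma jacobi_vec_mat_carrier: "jacobi_vec_mat n x w \<in> carrier_mat n n"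
  by (simp add: jacobi_vec_mat_def)

lemma jacobi_mat_eq:
  "jacobi_mat n x w = jacobi_vec_mat n x w * mat_diag n x * transpose_mat (jacobi_vec_mat n x w)"
  by (subst mat_diag_mult_right[OF jacobi_vec_mat_carrier], rule eq_matI)
     (auto simp: jacobi_mat_def jacobi_vec_mat_def jacobi_entry_def scalar_prod_def
        atLeast0LessThan intro!: sum.cong)

lemma jacobi_entry_commute: "jacobi_entry n x w j k = jacobi_entry n x w k j"
  by (simp add: jacobi_entry_def mult.commute mult.left_commute)

context simple_measure
begin

lemma jacobi_entry_eq:
  "jacobi_entry n x w j k = ip n w (\<lambda>i. x i * opoly n x w j i) (opoly n x w k)
     / (sqrt (sqnorm n x w j) * sqrt (sqnorm n x w k))"
proof -
  have "jacobi_vec n x w j i * x i * jacobi_vec n x w k i =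
      w i * (x i * opoly n x w j i) * opoly n x w k i / (sqrt (sqnorm n x w j) * sqrt (sqnorm n x w k))"
    if "i < n" for i
  proof -
    have "w i = sqrt (w i) * sqrt (w i)" using pos[OF that] by simp
    then show ?thesis by (simp add: jacobi_vec_def)
  qed
  then show ?thesis
    by (simp add: jacobi_entry_def ip_def sum_divide_distrib)
qed

lemma jacobi_entry_diag: "j < n \<Longrightarrow> jacobi_entry n x w j j = rec_alpha n x w j"
  using sqnorm_pos[of j] by (simp add: jacobi_entry_eq rec_alpha_def)

lemma jacobi_entry_Suc:
  "Suc j < n \<Longrightarrow> jacobi_entry n x w j (Suc j) =
     sqnorm n x w (Suc j) / (sqrt (sqnorm n x w j) * sqrt (sqnorm n x w (Suc j)))"
  by (simp add: jacobi_entry_eq jacobi_subdiagonal)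

lemma jacobi_entry_eq_0:
  "j < n \<Longrightarrow> k < n \<Longrightarrow> Suc j < k \<or> Suc k < j \<Longrightarrow> jacobi_entry n x w j k = 0"
  using jacobi_tridiagonal[of j k] jacobi_tridiagonal[of k j] jacobi_entry_commute[of n x w j k]
  by (auto simp: jacobi_entry_eq)

lemma jacobi_vec_orthonormal:
  assumes "j < n" "k < n"
  shows "(\<Sum>i<n. jacobi_vec n x w j i * jacobi_vec n x w k i) = (if j = k then 1 else 0)"
proof -
  have "jacobi_vec n x w j i * jacobi_vec n x w k i =
      w i * opoly n x w j i * opoly n x w k i / (sqrt (sqnorm n x w j) * sqrt (sqnorm n x w k))"
    if "i < n" for i
  proof -
    have "w i = sqrt (w i) * sqrt (w i)" using pos[OF that] by simp
    then show ?thesis by (simp add: jacobi_vec_def)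
  qed
  then have "(\<Sum>i<n. jacobi_vec n x w j i * jacobi_vec n x w k i) =
      ip n w (opoly n x w j) (opoly n x w k) / (sqrt (sqnorm n x w j) * sqrt (sqnorm n x w k))"
    by (simp add: ip_def sum_divide_distrib)
  then show ?thesis
    using assms sqnorm_pos[of j] by (auto simp: opoly_orthogonal)
qed

lemma real_orthogonal_jacobi_vec_mat: "real_orthogonal n (jacobi_vec_mat n x w)"
proof -
  let ?Q = "jacobi_vec_mat n x w"
  have 1: "?Q * transpose_mat ?Q = 1\<^sub>m n"
    by (rule eq_matI)
       (auto simp: jacobi_vec_mat_def scalar_prod_def atLeast0LessThan jacobi_vec_orthonormal)
  \<comment> \<open>The matrix is square, so its right inverse is also a left inverse.\<close>
  have "transpose_mat ?Q * ?Q = 1\<^sub>m n"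
    by (rule mat_mult_left_right_inverse[OF _ _ 1]) (auto simp: jacobi_vec_mat_carrier)
  with 1 show ?thesis
    by (simp add: real_orthogonal_def jacobi_vec_mat_carrier)
qed

lemma symmetric_tridiagonal_jacobi_mat: "symmetric_tridiagonal n (jacobi_mat n x w)"
  by (auto simp: symmetric_tridiagonal_def jacobi_mat_def jacobi_entry_eq_0
      intro!: eq_matI jacobi_entry_commute)

end

section \<open>Regularity of the Jacobi matrix\<close>

text \<open>The Chebyshev algorithm, row by row: a new entry is a rational function of entries in
  earlier rows whose denominators are positive squared norms. No index sum exceeds that of the new
  entry, so moments of order less than \<open>n\<close> suffice.\<close>

lemma fv_path_mixed_moment:
  assumes sm: "\<And>t. simple_measure n (x t) (w t)"
    and mom: "\<And>l. l < n \<Longrightarrow> fv_path (\<lambda>t. \<Sum>i<n. w t i * x t i ^ l)"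
  shows "j \<le> l \<Longrightarrow> j + l < n \<Longrightarrow> fv_path (\<lambda>t. mixed_moment n (x t) (w t) j l)"
proof (induction j arbitrary: l rule: less_induct)
  case (less j)
  show ?case
  proof (cases j)
    case 0
    then show ?thesis
      using mom[of l] less.prems by (simp add: mixed_moment_def ip_def)
  next
    case (Suc k)
    define \<sigma> h \<beta> where "\<sigma> j l t = mixed_moment n (x t) (w t) j l"
      and "h j t = sqnorm n (x t) (w t) j" and "\<beta> j t = rec_beta n (x t) (w t) j" for j l t
    have IH: "fv_path (\<sigma> i m)" if "i < j" "i \<le> m" "i + m < n" for i m
      unfolding \<sigma>_def using less.IH that by blast
    have k: "Suc (k + k) < n" and l: "k < l" "Suc (k + l) < n"
      using Suc less.prems by auto
    have hfv: "fv_path (h i)" if "i \<le> k" for i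
    proof -
      have "h i = \<sigma> i i"
        using simple_measure.mixed_moment_diag[OF sm, of i] k that
        by (auto simp: h_def \<sigma>_def fun_eq_iff)
      then show ?thesis using IH[of i i] Suc that k by simp
    qed
    have hpos: "h i t > 0" if "i \<le> k" for i t
      unfolding h_def using simple_measure.sqnorm_pos[OF sm] k that by simp
    \<comment> \<open>For k = 0 \<open>rec_beta\<close> is 0 by convention. Otherwise the bound says
      that the entry in row k - 1 has index sum below \<open>n\<close>.\<close>
    have \<beta>\<sigma>: "fv_path (\<lambda>t. \<beta> k t * \<sigma> (k - 1) m t)" if "k \<le> m" "k + m < Suc n" for m
    proof (cases "k = 0")
      case True
      then show ?thesis by (simp add: \<beta>_def rec_beta_def fv_path_const)
    next
      case False
      then have "fv_path (\<lambda>t. h k t / h (k - 1) t * \<sigma> (k - 1) m t)"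
        using that Suc by (intro fv_path_mult fv_path_divide hfv hpos IH) auto
      then show ?thesis
        using False by (simp add: \<beta>_def h_def rec_beta_def)
    qed
    have "\<sigma> j l t = \<sigma> k (Suc l) t
        - (\<sigma> k (Suc k) t - \<beta> k t * \<sigma> (k - 1) k t) / h k t * \<sigma> k l t - \<beta> k t * \<sigma> (k - 1) l t" for t
      using mixed_moment_Suc[of n "x t" "w t" k l] simple_measure.rec_alpha_eq[OF sm k, of t]
      by (simp add: \<sigma>_def h_def \<beta>_def Suc)
    moreover have "fv_path (\<lambda>t. \<sigma> k (Suc l) t
        - (\<sigma> k (Suc k) t - \<beta> k t * \<sigma> (k - 1) k t) / h k t * \<sigma> k l t - \<beta> k t * \<sigma> (k - 1) l t)"
      using k l Suc by (intro fv_path_diff fv_path_mult fv_path_divide IH \<beta>\<sigma> hfv hpos) auto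
    ultimately show ?thesis
      unfolding \<sigma>_def by simp
  qed
qed

text \<open>A diagonal entry needs the table up to (j, j + 1), an entry next to the diagonal up to
  (j + 1, j + 1). In both cases the index sum is j + k + 1, which gives the bound.\<close>

lemma fv_path_jacobi_entry:
  assumes sm: "\<And>t. simple_measure n (x t) (w t)"
    and mom: "\<And>l. l < n \<Longrightarrow> fv_path (\<lambda>t. \<Sum>i<n. w t i * x t i ^ l)"
    and "Suc (j + k) < n"
  shows "fv_path (\<lambda>t. jacobi_entry n (x t) (w t) j k)"
  using assms(3)
proof (induction j k rule: linorder_wlog)
  case (sym j k)
  then show ?case by (simp add: jacobi_entry_commute add.commute)
next
  case (le j k)
  note mm = fv_path_mixed_moment[of n x w, OF sm mom]
  note pos = simple_measure.sqnorm_pos[OF sm]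
  have hfv: "fv_path (\<lambda>t. sqnorm n (x t) (w t) i)" if "i + i < n" for i
    using mm[of i i] simple_measure.mixed_moment_diag[OF sm that] that by simp
  consider "k = j" | "k = Suc j" | "Suc j < k"
    using le.hyps by linarith
  then show ?case
  proof cases
    case 1
    have "fv_path (\<lambda>t. rec_beta n (x t) (w t) j * mixed_moment n (x t) (w t) (j - 1) j)"
    proof (cases "j = 0")
      case True
      then show ?thesis by (simp add: rec_beta_def fv_path_const)
    next
      case False
      then have "fv_path (\<lambda>t. sqnorm n (x t) (w t) j / sqnorm n (x t) (w t) (j - 1)
          * mixed_moment n (x t) (w t) (j - 1) j)"
        using le.prems 1 by (intro fv_path_mult fv_path_divide hfv mm pos) auto
      then show ?thesis using False by (simp add: rec_beta_def)
    qed
    then have "fv_path (\<lambda>t. (mixed_moment n (x t) (w t) j (Suc j) -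
        rec_beta n (x t) (w t) j * mixed_moment n (x t) (w t) (j - 1) j) / sqnorm n (x t) (w t) j)"
      using le.prems 1 by (intro fv_path_diff fv_path_divide mm hfv pos) auto
    then show ?thesis
      using 1 le.prems
      by (simp add: simple_measure.jacobi_entry_diag[OF sm] simple_measure.rec_alpha_eq[OF sm])
  next
    case 2
    have "fv_path (\<lambda>t. sqnorm n (x t) (w t) k
        / (sqrt (sqnorm n (x t) (w t) j) * sqrt (sqnorm n (x t) (w t) k)))"
      using le.prems 2
      by (intro fv_path_divide fv_path_mult fv_path_sqrt hfv mult_pos_pos) (auto intro!: pos)
    then show ?thesis
      using 2 le.prems by (simp add: simple_measure.jacobi_entry_Suc[OF sm])
  next
    case 3
    then show ?thesis
      using le.prems by (simp add: simple_measure.jacobi_entry_eq_0[OF sm] fv_path_const)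
  qed
qed

section \<open>Continuity and measurability of the eigenvectors\<close>

lemma continuous_on_opoly:
  assumes sm: "\<And>t. simple_measure n (x t) (w t)"
    and x: "\<And>i. i < n \<Longrightarrow> continuous_on S (\<lambda>t. x t i)"
    and w: "\<And>i. i < n \<Longrightarrow> continuous_on S (\<lambda>t. w t i)"
  shows "j < n \<Longrightarrow> i < n \<Longrightarrow> continuous_on S (\<lambda>t. opoly n (x t) (w t) j i)"
proof (induction j arbitrary: i rule: less_induct)
  case (less j)
  show ?case
  proof (cases j)
    case 0
    then show ?thesis by simp
  next
    case (Suc k)
    have IH: "continuous_on S (\<lambda>t. opoly n (x t) (w t) m i)" if "m \<le> k" "i < n" for m i
      using less Suc that by simp
    have h: "continuous_on S (\<lambda>t. sqnorm n (x t) (w t) m)" if "m \<le> k" for m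
      unfolding sqnorm_def ip_def using that by (intro continuous_intros IH w) auto
    \<comment> \<open>The divisions in the recurrence are continuous because squared norms of degree
      below \<open>n\<close> never vanish.\<close>
    have h0: "sqnorm n (x t) (w t) m \<noteq> 0" if "m \<le> k" for m t
      using simple_measure.sqnorm_pos[OF sm, of m t] less.prems Suc that by auto
    have a: "continuous_on S (\<lambda>t. rec_alpha n (x t) (w t) k)"
      unfolding rec_alpha_def ip_def using h0 by (intro continuous_intros IH w x h) auto
    have b: "continuous_on S (\<lambda>t. rec_beta n (x t) (w t) k)"
      unfolding rec_beta_def using h0 by (cases "k = 0") (auto intro!: continuous_intros h)
    have "opoly n (x t) (w t) j i = x t i * opoly n (x t) (w t) k i
        - rec_alpha n (x t) (w t) k * opoly n (x t) (w t) k i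
        - rec_beta n (x t) (w t) k * opoly n (x t) (w t) (k - 1) i" for t
      using opoly_recurrence[of "x t" i n "w t" k] Suc by simp
    moreover have "continuous_on S (\<lambda>t. x t i * opoly n (x t) (w t) k i
        - rec_alpha n (x t) (w t) k * opoly n (x t) (w t) k i
        - rec_beta n (x t) (w t) k * opoly n (x t) (w t) (k - 1) i)"
      using less.prems by (intro continuous_intros IH a b x) auto
    ultimately show ?thesis by simp
  qed
qed

lemma continuous_on_jacobi_vec:
  assumes sm: "\<And>t. simple_measure n (x t) (w t)"
    and x: "\<And>i. i < n \<Longrightarrow> continuous_on S (\<lambda>t. x t i)"
    and w: "\<And>i. i < n \<Longrightarrow> continuous_on S (\<lambda>t. w t i)"
    and "j < n" "i < n"
  shows "continuous_on S (\<lambda>t. jacobi_vec n (x t) (w t) j i)"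
proof -
  note op = continuous_on_opoly[of n x w, OF sm x w]
  have "sqnorm n (x t) (w t) j > 0" for t
    by (rule simple_measure.sqnorm_pos[OF sm \<open>j < n\<close>])
  then show ?thesis
    using assms(4,5) unfolding jacobi_vec_def
    by (intro continuous_intros op w)
       (auto simp: sqnorm_def ip_def less_imp_neq[symmetric] intro!: continuous_intros op w)
qed

text \<open>Real division, with value 0 at denominator 0, preserves measurability, so the recurrence
  transfers it from degree to degree.\<close>

lemma measurable_opoly:
  assumes [measurable]: "\<And>i. i < n \<Longrightarrow> (\<lambda>\<omega>. x \<omega> i) \<in> borel_measurable N"
    "\<And>i. i < n \<Longrightarrow> (\<lambda>\<omega>. w \<omega> i) \<in> borel_measurable N"
  shows "i < n \<Longrightarrow> (\<lambda>\<omega>. opoly n (x \<omega>) (w \<omega>) j i) \<in> borel_measurable N"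
proof (induction j arbitrary: i rule: less_induct)
  case (less j)
  note [measurable] = less.prems
  show ?case
  proof (cases j)
    case 0
    then show ?thesis by simp
  next
    case (Suc k)
    have [measurable]: "(\<lambda>\<omega>. opoly n (x \<omega>) (w \<omega>) k i) \<in> borel_measurable N"
      "(\<lambda>\<omega>. opoly n (x \<omega>) (w \<omega>) (k - 1) i) \<in> borel_measurable N" if "i < n" for i
      using less Suc that by auto
    have "(\<lambda>\<omega>. x \<omega> i * opoly n (x \<omega>) (w \<omega>) k i
        - rec_alpha n (x \<omega>) (w \<omega>) k * opoly n (x \<omega>) (w \<omega>) k i
        - rec_beta n (x \<omega>) (w \<omega>) k * opoly n (x \<omega>) (w \<omega>) (k - 1) i) \<in> borel_measurable N"
      unfolding rec_alpha_def rec_beta_def sqnorm_def ip_def using less.prems by measurable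
    moreover have "opoly n (x \<omega>) (w \<omega>) j i = x \<omega> i * opoly n (x \<omega>) (w \<omega>) k i
        - rec_alpha n (x \<omega>) (w \<omega>) k * opoly n (x \<omega>) (w \<omega>) k i
        - rec_beta n (x \<omega>) (w \<omega>) k * opoly n (x \<omega>) (w \<omega>) (k - 1) i" for \<omega>
      using opoly_recurrence[of "x \<omega>" i n "w \<omega>" k] Suc by simp
    ultimately show ?thesis by simp
  qed
qed

lemma measurable_jacobi_vec:
  assumes [measurable]: "\<And>i. i < n \<Longrightarrow> (\<lambda>\<omega>. x \<omega> i) \<in> borel_measurable N"
    "\<And>i. i < n \<Longrightarrow> (\<lambda>\<omega>. w \<omega> i) \<in> borel_measurable N"
    and "i < n"
  shows "(\<lambda>\<omega>. jacobi_vec n (x \<omega>) (w \<omega>) j i) \<in> borel_measurable N"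
proof -
  have [measurable]: "(\<lambda>\<omega>. opoly n (x \<omega>) (w \<omega>) j i) \<in> borel_measurable N" if "i < n" for i
    using that by (intro measurable_opoly) auto
  show ?thesis
    unfolding jacobi_vec_def sqnorm_def ip_def using \<open>i < n\<close> by measurable
qed

section \<open>Lagrange interpolation\<close>

definition lagrange :: "nat \<Rightarrow> (nat \<Rightarrow> real) \<Rightarrow> nat \<Rightarrow> real poly" where
  "lagrange n y i = (\<Prod>j\<in>{..<n} - {i}. Polynomial.smult (1 / (y i - y j)) [:- y j, 1:])"

abbreviation lagrange_coeff :: "nat \<Rightarrow> (nat \<Rightarrow> real) \<Rightarrow> nat \<Rightarrow> nat \<Rightarrow> real" where
  "lagrange_coeff n y i k \<equiv> Polynomial.coeff (lagrange n y i) k"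

lemma degree_lagrange:
  assumes "i < n"
  shows "Polynomial.degree (lagrange n y i) < n"
proof -
  have "Polynomial.degree (lagrange n y i)
      \<le> (\<Sum>j\<in>{..<n} - {i}. Polynomial.degree (Polynomial.smult (1 / (y i - y j)) [:- y j, 1:]))"
    unfolding lagrange_def using degree_prod_sum_le
    by (metis (lifting) comp_apply finite_Diff finite_lessThan sum.cong)
  also have "\<dots> \<le> (\<Sum>j\<in>{..<n} - {i}. 1)"
    by (intro sum_mono order.trans[OF degree_smult_le]) auto
  also have "\<dots> < n"
    using assms by simp
  finally show ?thesis .
qed

lemma poly_lagrange:
  assumes "inj_on y {..<n}" "i < n" "k < n"
  shows "poly (lagrange n y i) (y k) = (if k = i then 1 else 0)"
proof (cases "k = i")
  case True
  then show ?thesis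
    using assms unfolding lagrange_def poly_prod
    by (auto intro!: prod.neutral simp: inj_on_def simp flip: diff_divide_distrib
        split: if_splits)
next
  case False
  then show ?thesis
    using assms unfolding lagrange_def poly_prod by (auto intro!: prod_zero bexI[of _ k])
qed

lemma poly_eq_sum_coeff:
  fixes p :: "'a::comm_semiring_1 poly"
  assumes "Polynomial.degree p < n"
  shows "poly p z = (\<Sum>k<n. Polynomial.coeff p k * z ^ k)"
  unfolding poly_altdef using assms
  by (intro sum.mono_neutral_left) (auto simp: coeff_eq_0)

text \<open>The coefficients of the Lagrange basis form the inverse of the Vandermonde matrix of the
  nodes: this is the product in one order, the next lemma the product in the other.\<close>

lemma sum_lagrange_coeff_power:
  assumes "inj_on y {..<n}" "i < n" "i' < n"
  shows "(\<Sum>k<n. lagrange_coeff n y i k * y i' ^ k) = (if i' = i then 1 else 0)"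
  using poly_lagrange[OF assms] poly_eq_sum_coeff[OF degree_lagrange[OF assms(2)]] by metis

text \<open>Interpolating the monomial of degree l < n at \<open>n\<close> nodes returns this
  monomial; then coefficients are compared.\<close>

lemma sum_lagrange_coeff_nodes:
  assumes "inj_on y {..<n}" "l < n"
  shows "(\<Sum>i<n. lagrange_coeff n y i k * y i ^ l) = (if k = l then 1 else 0)"
proof -
  let ?p = "\<Sum>i<n. Polynomial.smult (y i ^ l) (lagrange n y i)"
  have "?p = Polynomial.monom 1 l"
  proof (rule poly_eqI_degree[where A = "y ` {..<n}"])
    fix z assume "z \<in> y ` {..<n}"
    then obtain j where j: "j < n" "z = y j" by auto
    then show "poly ?p z = poly (Polynomial.monom 1 l) z"
      using assms(1) by (simp add: poly_sum poly_lagrange poly_monom if_distrib cong: if_cong)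
  next
    have "Polynomial.degree ?p < n"
      using assms(2) degree_lagrange
      by (intro degree_sum_less) (auto intro: le_less_trans[OF degree_smult_le])
    then show "Polynomial.degree ?p < card (y ` {..<n})"
      using assms(1) by (simp add: card_image)
    show "Polynomial.degree (Polynomial.monom (1::real) l) < card (y ` {..<n})"
      using assms by (simp add: card_image degree_monom_eq)
  qed
  then have "Polynomial.coeff ?p k = Polynomial.coeff (Polynomial.monom 1 l) k" by simp
  then show ?thesis by (simp add: coeff_sum mult.commute)
qed

text \<open>Allows continuity and measurability of the Lagrange coefficients to be proved by
  induction on the number of linear factors.\<close>

lemma coeff_linear_mult:
  fixes p :: "'a::comm_ring_1 poly"
  shows "Polynomial.coeff (Polynomial.smult a [:b, 1:] * p) k =
    a * (b * Polynomial.coeff p k + (case k of 0 \<Rightarrow> 0 | Suc m \<Rightarrow> Polynomial.coeff p m))"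
  by (simp add: coeff_pCons algebra_simps split: nat.split)

lemma continuous_on_lagrange_coeff:
  assumes y: "\<And>j. j < n \<Longrightarrow> continuous_on S (\<lambda>p. y p j)" and inj: "\<And>p. inj_on (y p) {..<n}" and i: "i < n"
  shows "continuous_on S (\<lambda>p. lagrange_coeff n (y p) i k)"
proof -
  have "continuous_on S (\<lambda>p. Polynomial.coeff (\<Prod>j\<in>J. Polynomial.smult (1 / (y p i - y p j)) [:- y p j, 1:]) k)"
    if "finite J" "J \<subseteq> {..<n} - {i}" for J k
    using that
  proof (induction J arbitrary: k rule: finite_induct)
    case empty
    then show ?case by simp
  next
    case (insert j J)
    then have "y p i - y p j \<noteq> 0" for p
      using inj[of p] i by (auto simp: inj_on_def)
    moreover have "continuous_on S (\<lambda>p. case k of 0 \<Rightarrow> 0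
        | Suc m \<Rightarrow> Polynomial.coeff (\<Prod>j\<in>J. Polynomial.smult (1 / (y p i - y p j)) [:- y p j, 1:]) m)"
      using insert by (cases k) auto
    ultimately show ?case
      using insert i unfolding prod.insert[OF insert.hyps] coeff_linear_mult
      by (intro continuous_intros y) auto
  qed
  then show ?thesis unfolding lagrange_def by simp
qed

lemma measurable_lagrange_coeff:
  assumes y: "\<And>j. j < n \<Longrightarrow> (\<lambda>\<omega>. y \<omega> j) \<in> borel_measurable N" and i: "i < n"
  shows "(\<lambda>\<omega>. lagrange_coeff n (y \<omega>) i k) \<in> borel_measurable N"
proof -
  have "(\<lambda>\<omega>. Polynomial.coeff (\<Prod>j\<in>J. Polynomial.smult (1 / (y \<omega> i - y \<omega> j)) [:- y \<omega> j, 1:]) k)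
      \<in> borel_measurable N"
    if "finite J" "J \<subseteq> {..<n}" for J k
    using that
  proof (induction J arbitrary: k rule: finite_induct)
    case empty
    then show ?case by simp
  next
    case (insert j J)
    have "(\<lambda>\<omega>. case k of 0 \<Rightarrow> 0
        | Suc m \<Rightarrow> Polynomial.coeff (\<Prod>j\<in>J. Polynomial.smult (1 / (y \<omega> i - y \<omega> j)) [:- y \<omega> j, 1:]) m)
        \<in> borel_measurable N"
      using insert by (cases k) auto
    then show ?case
      using insert i unfolding prod.insert[OF insert.hyps] coeff_linear_mult
      by (intro borel_measurable_times borel_measurable_add borel_measurable_divide
          borel_measurable_diff borel_measurable_uminus y) auto
  qed
  then show ?thesis unfolding lagrange_def by auto
qed

section \<open>Moments of finite variation and the associated weights\<close>

definition power_sum :: "nat \<Rightarrow> (nat \<Rightarrow> real) \<Rightarrow> nat \<Rightarrow> real" where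
  "power_sum n y k = (\<Sum>i<n. y i ^ k)"

text \<open>\<open>fit n y z i\<close> is the mass at \<open>z i\<close> of the signed measure on the nodes \<open>z\<close> whose moments
  of order less than \<open>n\<close> are those of the counting measure on \<open>y\<close>; \<open>overlap n y z\<close> is positive
  if and only if this measure is positive.\<close>

definition fit :: "nat \<Rightarrow> (nat \<Rightarrow> real) \<Rightarrow> (nat \<Rightarrow> real) \<Rightarrow> nat \<Rightarrow> real" where
  "fit n y z i = (\<Sum>k<n. lagrange_coeff n z i k * power_sum n y k)"

definition overlap :: "nat \<Rightarrow> (nat \<Rightarrow> real) \<Rightarrow> (nat \<Rightarrow> real) \<Rightarrow> real" where
  "overlap n y z = (\<Prod>i<n. max 0 (fit n y z i))"

text \<open>The moments of the configuration at time \<open>s\<close> are used with the coefficient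
  \<open>damping n x s t\<close>, which starts from zero at time \<open>s\<close> and returns to zero for good not later
  than the first time at which they stop being the moments of a positive measure on the current
  configuration. Hence every superposition of them is in the current cone of moments.\<close>

definition damping :: "nat \<Rightarrow> (real \<Rightarrow> nat \<Rightarrow> real) \<Rightarrow> real \<Rightarrow> real \<Rightarrow> real" where
  "damping n x s t = min (min 1 (max 0 (t - s))) (running_inf (\<lambda>r. overlap n (x s) (x r)) s t)"

text \<open>Negative rationals are included on purpose: the weights at time 0 come from start times
  before 0, where the paths will be extended by their initial values.\<close>

definition start_time :: "nat \<Rightarrow> real" where
  "start_time j = real_of_rat (from_nat j)"

text \<open>The denominator exceeds every power sum of order below \<open>n\<close>, so one
  geometric series dominates all the moment series. It involves the path at the start time
  only.\<close>

definition start_mass :: "nat \<Rightarrow> (real \<Rightarrow> nat \<Rightarrow> real) \<Rightarrow> nat \<Rightarrow> real" where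
  "start_mass n x j = (1/2) ^ j / (1 + (\<Sum>k<n. \<bar>power_sum n (x (start_time j)) k\<bar>))"

definition moment :: "nat \<Rightarrow> (real \<Rightarrow> nat \<Rightarrow> real) \<Rightarrow> nat \<Rightarrow> real \<Rightarrow> real" where
  "moment n x l t = (\<Sum>j. start_mass n x j * power_sum n (x (start_time j)) l * damping n x (start_time j) t)"

text \<open>Solves the Vandermonde system on the current nodes with right-hand side
  \<open>moment\<close>.\<close>

definition weight :: "nat \<Rightarrow> (real \<Rightarrow> nat \<Rightarrow> real) \<Rightarrow> real \<Rightarrow> nat \<Rightarrow> real" where
  "weight n x t i = (\<Sum>k<n. lagrange_coeff n (x t) i k * moment n x k t)"

lemma overlap_nonneg: "overlap n y z \<ge> 0"
  unfolding overlap_def by (intro prod_nonneg) auto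

lemma overlap_pos_iff: "overlap n y z > 0 \<longleftrightarrow> (\<forall>i<n. fit n y z i > 0)"
  using overlap_nonneg[of n y z] unfolding less_le overlap_def
  by (auto simp: eq_commute[of 0] max_def split: if_splits)

text \<open>The counting measure is fitted on its own nodes by itself, with all masses 1.\<close>

lemma overlap_self:
  assumes "inj_on y {..<n}"
  shows "overlap n y y = 1"
proof -
  have "fit n y y i = 1" if "i < n" for i
  proof -
    have "fit n y y i = (\<Sum>i'<n. \<Sum>k<n. lagrange_coeff n y i k * y i' ^ k)"
      unfolding fit_def power_sum_def sum_distrib_left by (rule sum.swap)
    then show ?thesis
      using that by (simp add: sum_lagrange_coeff_power[OF assms])
  qed
  then show ?thesis by (simp add: overlap_def)
qed

lemma damping_eq_0: "t \<le> s \<Longrightarrow> damping n x s t = 0"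
  using running_inf_ge[of s t 0 "\<lambda>r. overlap n (x s) (x r)"] overlap_nonneg
  by (simp add: damping_def)

lemma damping_nonneg: "damping n x s t \<ge> 0"
  using running_inf_ge[of s t 0 "\<lambda>r. overlap n (x s) (x r)"] overlap_nonneg
  by (simp add: damping_def)

lemma damping_le_1: "damping n x s t \<le> 1"
  by (simp add: damping_def)

lemma start_mass_pos: "start_mass n x j > 0"
  unfolding start_mass_def by (intro divide_pos_pos add_pos_nonneg sum_nonneg) auto

lemma start_mass_power_sum_le:
  assumes "l < n"
  shows "\<bar>start_mass n x j * power_sum n (x (start_time j)) l\<bar> \<le> (1/2) ^ j"
proof -
  let ?a = "\<lambda>k. \<bar>power_sum n (x (start_time j)) k\<bar>"
  have "?a l \<le> sum ?a {..<n}"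
    using assms by (intro member_le_sum) auto
  then have "(1/2) ^ j * ?a l \<le> (1/2) ^ j * (1 + sum ?a {..<n})"
    by (intro mult_left_mono) auto
  moreover have "1 + sum ?a {..<n} > 0"
    by (intro add_pos_nonneg sum_nonneg) auto
  ultimately have "(1/2) ^ j * ?a l / (1 + sum ?a {..<n}) \<le> (1/2) ^ j"
    by (subst pos_divide_le_eq) auto
  then show ?thesis
    using start_mass_pos[of n x j] by (simp add: abs_mult start_mass_def)
qed

lemma summable_start_mass:
  assumes "l < n"
  shows "summable (\<lambda>j. \<bar>start_mass n x j * power_sum n (x (start_time j)) l\<bar>)"
  using start_mass_power_sum_le[OF assms]
  by (intro summable_comparison_test[OF _ summable_geometric[of "1/2::real"]]) auto

lemma summable_moment:
  assumes "l < n"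
  shows "summable (\<lambda>j. start_mass n x j * power_sum n (x (start_time j)) l * damping n x (start_time j) t)"
  using damping_nonneg damping_le_1
  by (intro summable_comparison_test[OF _ summable_start_mass[OF assms, of x]])
     (auto simp: abs_mult intro!: mult_left_le)

text \<open>The fit is linear in the moments, and a finite sum commutes with the series. In this
  form the weight is a combination of fits with nonnegative coefficients, from which its sign is
  read off.\<close>

lemma weight_eq:
  shows "weight n x t i =
      (\<Sum>j. start_mass n x j * damping n x (start_time j) t * fit n (x (start_time j)) (x t) i)"
    and summable_weight: "summable (\<lambda>j. start_mass n x j * damping n x (start_time j) t
          * fit n (x (start_time j)) (x t) i)"
proof -
  let ?a = "\<lambda>k j. lagrange_coeff n (x t) i k *
      (start_mass n x j * power_sum n (x (start_time j)) k * damping n x (start_time j) t)"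
  have s: "summable (?a k)" if "k < n" for k
    by (intro summable_mult summable_moment that)
  have eq: "(\<lambda>j. start_mass n x j * damping n x (start_time j) t * fit n (x (start_time j)) (x t) i)
      = (\<lambda>j. \<Sum>k<n. ?a k j)"
    by (simp add: fit_def sum_distrib_left algebra_simps)
  show "summable (\<lambda>j. start_mass n x j * damping n x (start_time j) t
          * fit n (x (start_time j)) (x t) i)"
    unfolding eq by (intro summable_sum s) auto
  have "weight n x t i = (\<Sum>k<n. suminf (?a k))"
    unfolding weight_def moment_def by (intro sum.cong suminf_mult[symmetric] summable_moment) auto
  also have "\<dots> = (\<Sum>j. \<Sum>k<n. ?a k j)"
    by (intro suminf_sum[symmetric] s) auto
  finally show "weight n x t i =
      (\<Sum>j. start_mass n x j * damping n x (start_time j) t * fit n (x (start_time j)) (x t) i)"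
    unfolding eq .
qed

text \<open>Start times not before \<open>t\<close> contribute nothing; for earlier ones the running
  infimum is a countable infimum of overlaps at times up to \<open>t\<close>. Hence only the path up
  to \<open>t\<close> enters.\<close>

lemma measurable_weight:
  assumes x: "\<And>r i. r \<le> t \<Longrightarrow> i < n \<Longrightarrow> (\<lambda>\<omega>. x \<omega> r i) \<in> borel_measurable N" and i: "i < n"
  shows "(\<lambda>\<omega>. weight n (x \<omega>) t i) \<in> borel_measurable N"
proof -
  have ps[measurable]: "(\<lambda>\<omega>. power_sum n (x \<omega> r) k) \<in> borel_measurable N" if "r \<le> t" for r k
    unfolding power_sum_def using that by (intro borel_measurable_sum borel_measurable_power x) auto
  have lc[measurable]: "(\<lambda>\<omega>. lagrange_coeff n (x \<omega> r) i k) \<in> borel_measurable N"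
    if "r \<le> t" "i < n" for r i k
    by (rule measurable_lagrange_coeff[OF x that(2)]) (use that in auto)
  have ov: "(\<lambda>\<omega>. overlap n (x \<omega> s) (x \<omega> r)) \<in> borel_measurable N" if [simp]: "s \<le> t" "r \<le> t" for s r
    unfolding overlap_def fit_def by measurable
  have summand: "(\<lambda>\<omega>. start_mass n (x \<omega>) j * power_sum n (x \<omega> (start_time j)) k * damping n (x \<omega>) (start_time j) t)
      \<in> borel_measurable N" for j k
  proof (cases "start_time j < t")
    case True
    let ?s = "start_time j"
    have [simp]: "?s \<le> t" using True by simp
    have "countable (insert ?s ({?s<..<t} \<inter> \<rat>))"
      by (simp add: countable_Int2 countable_rat)
    then have [measurable]: "(\<lambda>\<omega>. damping n (x \<omega>) ?s t) \<in> borel_measurable N"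
      unfolding damping_def running_inf_def using True
      by (intro borel_measurable_min borel_measurable_const borel_measurable_cINF_real ov) auto
    show ?thesis
      unfolding start_mass_def by measurable
  next
    case False
    then show ?thesis by (simp add: damping_eq_0)
  qed
  show ?thesis
    unfolding weight_def moment_def
    by (intro borel_measurable_sum borel_measurable_times borel_measurable_suminf summand lc i) auto
qed

section \<open>Finite variation of the moments and positivity of the weights along continuous simple
  paths\<close>

locale simple_paths =
  fixes n :: nat and x :: "real \<Rightarrow> nat \<Rightarrow> real"
  assumes cont: "\<And>i. i < n \<Longrightarrow> continuous_on UNIV (\<lambda>t. x t i)"
    and inj: "\<And>t. inj_on (x t) {..<n}"
begin

text \<open>Joint continuity in both times is what \<open>damping_pos_exists\<close> needs, where
  the start time varies as well.\<close>

lemma continuous_on_overlap: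
  "continuous_on UNIV (\<lambda>p. overlap n (x (fst p)) (x (snd p)))"
proof -
  have x1: "continuous_on UNIV (\<lambda>p::real \<times> real. x (fst p) i)"
    and x2: "continuous_on UNIV (\<lambda>p::real \<times> real. x (snd p) i)" if "i < n" for i
    by (rule continuous_on_compose2[OF cont[OF that]]; auto intro!: continuous_intros)+
  have "continuous_on UNIV (\<lambda>p::real \<times> real. lagrange_coeff n (x (snd p)) i k)" if "i < n" for i k
    by (rule continuous_on_lagrange_coeff[where y = "\<lambda>p. x (snd p)", OF x2 inj that])
  then show ?thesis
    unfolding overlap_def fit_def power_sum_def by (intro continuous_intros x1) auto
qed

lemma continuous_on_overlap_right: "continuous_on UNIV (\<lambda>r. overlap n (x s) (x r))"
  using continuous_on_compose2[OF continuous_on_overlap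
      continuous_on_Pair[OF continuous_on_const[of UNIV s] continuous_on_id]] by simp

lemma running_inf_overlap_le_1: "running_inf (\<lambda>r. overlap n (x s) (x r)) s t \<le> 1"
  using running_inf_le[OF continuous_on_overlap_right overlap_nonneg, of s s t s]
  by (simp add: overlap_self inj)

text \<open>Each damping is the minimum of a nondecreasing ramp and a nonincreasing running infimum.
  Its increments are dominated by those of ramp minus infimum, which is bounded by 1 for all start
  times alike.\<close>

lemma fv_path_moment:
  assumes "l < n"
  shows "fv_path (moment n x l)"
proof -
  let ?R = "\<lambda>j. running_inf (\<lambda>r. overlap n (x (start_time j)) (x r)) (start_time j)"
  let ?r = "\<lambda>j t. min 1 (max 0 (t - start_time j))"
  show ?thesis
    unfolding moment_def[abs_def]
  proof (rule fv_path_suminf[OF summable_start_mass[OF assms],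
        where g = "\<lambda>j t. ?r j t - ?R j t" and B = 1])
    show "continuous_on UNIV (damping n x (start_time j))" for j
      unfolding damping_def[abs_def]
      by (intro continuous_intros continuous_on_running_inf continuous_on_overlap_right overlap_nonneg)
    show "\<bar>damping n x (start_time j) t\<bar> \<le> 1" for j t
      using damping_nonneg damping_le_1 by simp
    show "\<bar>?r j t - ?R j t\<bar> \<le> 1" for j t
      using running_inf_overlap_le_1[of "start_time j" t]
        running_inf_ge[of "start_time j" t 0 "\<lambda>r. overlap n (x (start_time j)) (x r)"] overlap_nonneg
      by (auto simp: abs_le_iff)
    show "\<bar>damping n x (start_time j) v - damping n x (start_time j) u\<bar>
        \<le> (?r j v - ?R j v) - (?r j u - ?R j u)" if "u \<le> v" for j u v
    proof -
      have "?R j v \<le> ?R j u" "?r j u \<le> ?r j v"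
        using that by (auto intro: running_inf_antimono overlap_nonneg)
      moreover have "\<bar>min a b - min a' b'\<bar> \<le> (a - b) - (a' - b')"
        if "a' \<le> a" "b \<le> b'" for a a' b b' :: real
        using that by (auto simp: min_def abs_if)
      ultimately show ?thesis
        unfolding damping_def by blast
    qed
  qed
qed

text \<open>Vandermonde inversion: the moments of the weighted nodes are the prescribed ones, hence
  of finite variation.\<close>

lemma sum_weight_power:
  assumes "l < n"
  shows "(\<Sum>i<n. weight n x t i * x t i ^ l) = moment n x l t"
proof -
  have "(\<Sum>i<n. weight n x t i * x t i ^ l)
      = (\<Sum>i<n. \<Sum>k<n. moment n x k t * (lagrange_coeff n (x t) i k * x t i ^ l))"
    unfolding weight_def sum_distrib_right by (intro sum.cong refl) (simp only: mult_ac)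
  also have "\<dots> = (\<Sum>k<n. moment n x k t * (\<Sum>i<n. lagrange_coeff n (x t) i k * x t i ^ l))"
    by (subst sum.swap) (simp add: sum_distrib_left)
  also have "\<dots> = moment n x l t"
    using assms by (simp add: sum_lagrange_coeff_nodes[OF inj] if_distrib cong: if_cong)
  finally show ?thesis .
qed

lemma continuous_on_weight: "i < n \<Longrightarrow> continuous_on UNIV (\<lambda>t. weight n x t i)"
  unfolding weight_def
  by (intro continuous_intros continuous_on_lagrange_coeff cont inj fv_path_continuous fv_path_moment) auto

text \<open>Positive damping forces a positive running infimum, which bounds the overlap at time
  \<open>t\<close> from below.\<close>

lemma fit_pos:
  assumes "damping n x s t > 0" "i < n"
  shows "fit n (x s) (x t) i > 0"
proof -
  have "s < t"
    using assms(1) damping_eq_0[of t s n x] by (cases "t \<le> s") auto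
  then have "0 < overlap n (x s) (x t)"
    using assms(1) running_inf_le[OF continuous_on_overlap_right overlap_nonneg, of s t t s]
    by (simp add: damping_def)
  then show ?thesis
    using assms(2) by (simp add: overlap_pos_iff)
qed

text \<open>The overlap is 1 on the diagonal, so by continuity it stays above 1/2 between
  \<open>t\<close> and any rational start time shortly before \<open>t\<close>.\<close>

lemma damping_pos_exists: "\<exists>j. damping n x (start_time j) t > 0"
proof -
  have "\<exists>d>0. \<forall>p. dist p (t, t) < d \<longrightarrow> dist (overlap n (x (fst p)) (x (snd p))) (overlap n (x t) (x t)) < 1 / 2"
    using continuous_on_overlap[unfolded continuous_on_iff, rule_format, of "(t, t)" "1/2"] by auto
  then obtain d where d: "d > 0"
    "\<And>s r. dist (s, r) (t, t) < d \<Longrightarrow> dist (overlap n (x s) (x r)) 1 < 1 / 2"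
    by (auto simp: overlap_self inj)
  \<comment> \<open>With distance below d / 2, both coordinates of a pair (s, r) with s <= r <= t
    together deviate from \<open>t\<close> by less than \<open>d\<close>.\<close>
  obtain q where q: "t - d / 2 < real_of_rat q" "real_of_rat q < t"
    using of_rat_dense[of "t - d / 2" t] d(1) by auto
  define s where "s = real_of_rat q"
  have "start_time (to_nat q) = s"
    by (simp add: start_time_def s_def)
  moreover have "1 / 2 \<le> running_inf (\<lambda>r. overlap n (x s) (x r)) s t"
  proof (rule running_inf_ge)
    fix r assume r: "s \<le> r" "r \<le> max s t"
    have "dist (s, r) (t, t) \<le> \<bar>s - t\<bar> + \<bar>r - t\<bar>"
      by (simp add: dist_prod_def dist_real_def sqrt_sum_squares_le_sum_abs)
    also have "\<dots> < d"
      using r q by (simp add: s_def)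
    finally show "1 / 2 \<le> overlap n (x s) (x r)"
      using d(2)[of s r] unfolding dist_real_def by linarith
  qed
  ultimately have "damping n x (start_time (to_nat q)) t > 0"
    using q(2) by (simp add: damping_def s_def)
  then show ?thesis ..
qed

text \<open>In \<open>weight_eq\<close> every term is nonnegative, since a fit that is not positive
  occurs only with damping 0, and some term is positive.\<close>

lemma weight_pos:
  assumes "i < n"
  shows "weight n x t i > 0"
proof -
  let ?a = "\<lambda>j. start_mass n x j * damping n x (start_time j) t * fit n (x (start_time j)) (x t) i"
  have nn: "?a j \<ge> 0" for j
    using fit_pos[OF _ assms, of "start_time j" t] start_mass_pos[of n x j]
      damping_nonneg[of n x "start_time j" t]
    by (cases "damping n x (start_time j) t = 0") (auto intro!: mult_nonneg_nonneg simp: less_imp_le)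
  obtain j where "damping n x (start_time j) t > 0"
    using damping_pos_exists by blast
  then have "?a j > 0"
    using fit_pos[OF _ assms] start_mass_pos by (intro mult_pos_pos) auto
  then show ?thesis
    using suminf_pos2[OF summable_weight nn] unfolding weight_eq by blast
qed

lemma simple_measure_weight: "simple_measure n (x t) (weight n x t)"
  using inj weight_pos by unfold_locales auto

end

section \<open>The tridiagonal model\<close>

theorem corollary23:
  fixes M :: "'a measure" and F :: "real \<Rightarrow> 'a measure"
    and \<beta> :: real and V :: "real \<Rightarrow> real" and n :: nat
    and Z lam :: "nat \<Rightarrow> real \<Rightarrow> 'a \<Rightarrow> real"
  assumes "prob_space M" and "usual_filtration M F"
    and "\<beta> \<ge> 1" and "\<And>x. V differentiable (at x)" and "n \<ge> 1"
    and "dyson_brownian_motion M F \<beta> V n Z lam"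
  shows "\<exists>A. tridiagonal_model M F n lam A \<and>
    (\<forall>k\<in>{1..n}. \<forall>l\<in>{1..n}. k + l \<le> n \<longrightarrow>
       finite_variation_process M F (\<lambda>t \<omega>. A t \<omega> $$ (k - 1, l - 1)))"
proof -
  have filt: "filtration (space M) F" and null: "null_sets M \<subseteq> sets (F 0)"
    using assms(2) unfolding usual_filtration_def by blast+
  note space_F = filtration.space_F[OF filt] and sets_F = filtration.sets_F_mono[OF filt]
  have adapted: "lam i t \<in> borel_measurable (F t)" if "i < n" "t \<ge> 0" for i t
    using assms(6) that by (auto simp: dyson_brownian_motion_def continuous_adapted_def)
  have "AE \<omega> in M. \<forall>i. i < n \<longrightarrow> continuous_on {0..} (\<lambda>t. lam i t \<omega>)"
    using assms(6)
    by (subst AE_all_countable) (auto simp: dyson_brownian_motion_def continuous_adapted_def)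
  moreover have "AE \<omega> in M. inj_on (\<lambda>i. lam i 0 \<omega>) {..<n}"
      "AE \<omega> in M. \<forall>t>0. inj_on (\<lambda>i. lam i t \<omega>) {..<n}"
    using assms(6) by (auto simp: dyson_brownian_motion_def)
  ultimately have "AE \<omega> in M. (\<forall>i<n. continuous_on {0..} (\<lambda>t. lam i t \<omega>)) \<and>
      (\<forall>t\<ge>0. inj_on (\<lambda>i. lam i t \<omega>) {..<n})"
    by eventually_elim (metis less_eq_real_def)
  then obtain N where N: "N \<in> null_sets M"
    and good: "\<And>\<omega>. \<omega> \<in> space M - N \<Longrightarrow> (\<forall>i<n. continuous_on {0..} (\<lambda>t. lam i t \<omega>)) \<and>
      (\<forall>t\<ge>0. inj_on (\<lambda>i. lam i t \<omega>) {..<n})"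
    by (rule AE_E3) blast

  \<comment> \<open>On the null set \<open>N\<close> the particles are replaced by fixed distinct
    points, so that tridiagonality and orthogonality hold for every outcome. Elsewhere the path is
    extended to negative times by its initial value.\<close>
  define x where "x \<omega> t i = (if \<omega> \<in> N then real i else lam i (max 0 t) \<omega>)" for \<omega> t i
  define w where "w \<omega> t = weight n (x \<omega>) t" for \<omega> t
  have paths: "simple_paths n (x \<omega>)" if "\<omega> \<in> space M" for \<omega>
  proof
    show "continuous_on UNIV (\<lambda>t. x \<omega> t i)" if "i < n" for i
    proof (cases "\<omega> \<in> N")
      case True
      then show ?thesis by (simp add: x_def)
    next
      case False
      then have "continuous_on {0..} (\<lambda>t. lam i t \<omega>)"
        using good[of \<omega>] \<open>\<omega> \<in> space M\<close> that by blast
      then have "continuous_on UNIV (\<lambda>t. lam i (max 0 t) \<omega>)"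
        by (rule continuous_on_compose2) (auto intro!: continuous_intros)
      then show ?thesis using False by (simp add: x_def)
    qed
    show "inj_on (x \<omega> t) {..<n}" for t
    proof (cases "\<omega> \<in> N")
      case True
      then show ?thesis by (simp add: x_def inj_on_def)
    next
      case False
      then have "inj_on (\<lambda>i. lam i (max 0 t) \<omega>) {..<n}"
        using good[of \<omega>] that by simp
      then show ?thesis using False by (simp add: x_def[abs_def])
    qed
  qed
  note sm = simple_paths.simple_measure_weight[OF paths, folded w_def]

  have meas_x: "(\<lambda>\<omega>. x \<omega> r i) \<in> borel_measurable (F t)" if "0 \<le> t" "r \<le> t" "i < n" for r t i
  proof -
    \<comment> \<open>Modifying the paths on \<open>N\<close> keeps them adapted, because
      \<open>F 0\<close> contains all null sets.\<close>
    have "N \<in> sets (F t)"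
      using N null sets_F[OF that(1)] by blast
    \<comment> \<open>A negative \<open>r\<close> refers to time 0, and \<open>F 0\<close> is
      contained in \<open>F t\<close>.\<close>
    moreover have "subalgebra (F t) (F (max 0 r))"
      using sets_F[of "max 0 r" t] that by (simp add: subalgebra_def space_F)
    then have "lam i (max 0 r) \<in> borel_measurable (F t)"
      by (rule measurable_from_subalg) (use adapted that in simp)
    ultimately show ?thesis
      unfolding x_def by (intro measurable_If_set) auto
  qed
  have meas_w: "(\<lambda>\<omega>. w \<omega> t i) \<in> borel_measurable (F t)" if "0 \<le> t" "i < n" for t i
    unfolding w_def using that by (intro measurable_weight meas_x) auto
  have meas_vec: "(\<lambda>\<omega>. jacobi_vec n (x \<omega> t) (w \<omega> t) j i) \<in> borel_measurable (F t)"
    if "0 \<le> t" "i < n" for t i j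
    using that by (intro measurable_jacobi_vec meas_x meas_w) auto
  have cont_x: "continuous_on UNIV (\<lambda>t. x \<omega> t i)" if "\<omega> \<in> space M" "i < n" for \<omega> i
    using simple_paths.cont[OF paths] that by blast
  have cont_w: "continuous_on UNIV (\<lambda>t. w \<omega> t i)" if "\<omega> \<in> space M" "i < n" for \<omega> i
    using simple_paths.continuous_on_weight[OF paths] that by (simp add: w_def)
  have cont_vec: "continuous_on UNIV (\<lambda>t. jacobi_vec n (x \<omega> t) (w \<omega> t) j i)"
    if "\<omega> \<in> space M" "j < n" "i < n" for \<omega> j i
    using that by (intro continuous_on_jacobi_vec sm cont_x cont_w) auto

  have ca_vec: "continuous_adapted M F (\<lambda>t \<omega>. jacobi_vec n (x \<omega> t) (w \<omega> t) j i)"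
    if "j < n" "i < n" for j i
    unfolding continuous_adapted_def using that
    by (auto intro!: meas_vec continuous_on_subset[OF cont_vec])
  have ca_entry: "continuous_adapted M F (\<lambda>t \<omega>. jacobi_entry n (x \<omega> t) (w \<omega> t) j k)"
    if "j < n" "k < n" for j k
    unfolding continuous_adapted_def jacobi_entry_def
  proof (intro conjI allI impI AE_I2)
    show "(\<lambda>\<omega>. \<Sum>i<n. jacobi_vec n (x \<omega> t) (w \<omega> t) j i * x \<omega> t i * jacobi_vec n (x \<omega> t) (w \<omega> t) k i)
        \<in> borel_measurable (F t)" if "0 \<le> t" for t
      using that by (intro borel_measurable_sum borel_measurable_times meas_vec meas_x) auto
    show "continuous_on {0..}
        (\<lambda>t. \<Sum>i<n. jacobi_vec n (x \<omega> t) (w \<omega> t) j i * x \<omega> t i * jacobi_vec n (x \<omega> t) (w \<omega> t) k i)"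
      if "\<omega> \<in> space M" for \<omega>
      using that \<open>j < n\<close> \<open>k < n\<close>
      by (intro continuous_intros continuous_on_subset[OF cont_vec] continuous_on_subset[OF cont_x]) auto
  qed

  define A where "A t \<omega> = jacobi_mat n (x \<omega> t) (w \<omega> t)" for t \<omega>
  define Q where "Q t \<omega> = jacobi_vec_mat n (x \<omega> t) (w \<omega> t)" for t \<omega>
  have A: "A t \<omega> $$ (j, k) = jacobi_entry n (x \<omega> t) (w \<omega> t) j k" if "j < n" "k < n" for t \<omega> j k
    using that by (simp add: A_def jacobi_mat_def)
  have "matrix_process M F n A"
    using ca_entry by (simp add: matrix_process_def A) (simp add: A_def jacobi_mat_def)
  moreover have "matrix_process M F n Q"
    using ca_vec by (simp add: matrix_process_def Q_def jacobi_vec_mat_def)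
  moreover have "AE \<omega> in M. \<forall>t\<ge>0.
      A t \<omega> = Q t \<omega> * mat_diag n (\<lambda>i. lam i t \<omega>) * transpose_mat (Q t \<omega>)"
    using AE_not_in[OF N]
  proof eventually_elim
    case (elim \<omega>)
    \<comment> \<open>Off \<open>N\<close> the modified paths are the particle paths at all
      nonnegative times, so the spectral form of the Jacobi matrix is the required
      decomposition.\<close>
    then have "x \<omega> t = (\<lambda>i. lam i t \<omega>)" if "t \<ge> 0" for t
      using that by (simp add: x_def fun_eq_iff)
    then show ?case
      by (simp add: A_def Q_def jacobi_mat_eq)
  qed
  ultimately have "tridiagonal_model M F n lam A"
    unfolding tridiagonal_model_def
    using simple_measure.symmetric_tridiagonal_jacobi_mat[OF sm]
      simple_measure.real_orthogonal_jacobi_vec_mat[OF sm]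
    by (auto simp: A_def Q_def)
  moreover have "finite_variation_process M F (\<lambda>t \<omega>. A t \<omega> $$ (k - 1, l - 1))"
    if kl: "k \<in> {1..n}" "l \<in> {1..n}" "k + l \<le> n" for k l
  proof -
    have "fv_path (\<lambda>t. jacobi_entry n (x \<omega> t) (w \<omega> t) (k - 1) (l - 1))" if "\<omega> \<in> space M" for \<omega>
    proof (rule fv_path_jacobi_entry)
      show "simple_measure n (x \<omega> t) (w \<omega> t)" for t
        by (rule sm[OF that])
      show "fv_path (\<lambda>t. \<Sum>i<n. w \<omega> t i * x \<omega> t i ^ m)" if "m < n" for m
        using simple_paths.fv_path_moment[OF paths that] simple_paths.sum_weight_power[OF paths that]
          \<open>\<omega> \<in> space M\<close> by (simp add: w_def)
      \<comment> \<open>Shifting both indices to start from 0 turns k + l <= n into this strict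
        bound.\<close>
      show "Suc (k - 1 + (l - 1)) < n"
        using kl by auto
    qed
    then show ?thesis
      using kl ca_entry[of "k - 1" "l - 1"]
      by (auto simp: finite_variation_process_def A fv_path_bounded_variation)
  qed
  ultimately show ?thesis by blast
qed

end
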